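(* Let $0<\beta<1$, let $n>-1$ be real, and let $\mu,\nu$ be real. Then, for all $x>0$, the following hold. If $\mu>-\tfrac32$ and $-\tfrac12\le\nu<\mu+1$, then $$\int_0^x\frac{\tilde t_{\mu,\nu}(u)}{u^\nu}\,du>\frac{\tilde t_{\mu,\nu}(x)}{x^\nu}-\frac{x^{\mu-\nu+1}}{2^{\mu+1}\Gamma\big(\frac{\mu-\nu+3}{2}\big)\Gamma\big(\frac{\mu+\nu+3}{2}\big)}.$$ If $\mu>-\tfrac12(n+3)$ and $-\tfrac12(n+1)<\nu<\mu+1$, then one has the lower bound $$\int_0^x\frac{\tilde t_{\mu+n,\nu+n}(u)}{u^\nu}\,du>\frac{\tilde t_{\mu+n+1,\nu+n+1}(x)}{x^\nu}-b_{\mu,\nu,n}\,x^{\mu-\nu+n+2}$$ and the upper bound $$\int_0^x\frac{\tilde t_{\mu+n,\nu+n}(u)}{u^\nu}\,du<\frac{2(\nu+n+1)}{n+1}\frac{\tilde t_{\mu+n+1,\nu+n+1}(x)}{x^\nu}-\frac{2\nu+n+1}{n+1}\frac{\tilde t_{\mu+n+3,\nu+n+3}(x)}{x^\nu}+c_{\mu,\nu,n}\,x^{\mu-\nu+n+4}-d_{\mu,\nu,n}\,x^{\mu-\nu+n+2}.$$ If $\mu>-\tfrac32$ and $-\tfrac12\le\nu<\mu+1$, then $$\int_0^x e^{-\beta u}\frac{\tilde t_{\mu,\nu}(u)}{u^\nu}\,du>\frac{1}{1-\beta}\bigg(e^{-\beta x}\int_0^x\frac{\tilde t_{\mu,\nu}(u)}{u^\nu}\,du-\frac{\beta^{-(\mu-\nu+1)}\gamma(\mu-\nu+2,\beta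 x)}{2^{\mu+1}\Gamma\big(\frac{\mu-\nu+3}{2}\big)\Gamma\big(\frac{\mu+\nu+3}{2}\big)}\bigg),$$ $$\int_0^x e^{-\beta u}\frac{\tilde t_{\mu,\nu}(u)}{u^\nu}\,du>\frac{1}{1-\beta}\bigg(e^{-\beta x}\frac{\tilde t_{\mu,\nu}(x)}{x^\nu}-\frac{(\beta x)^{\mu-\nu+1}+\gamma(\mu-\nu+2,\beta x)}{2^{\mu+1}\beta^{\mu-\nu+1}\Gamma\big(\frac{\mu-\nu+3}{2}\big)\Gamma\big(\frac{\mu+\nu+3}{2}\big)}\bigg).$$ If instead $2\nu+n=-1$ (with $\mu>-\tfrac12(n+3)$ and $\nu<\mu+1$ still assumed), then the lower bound and the upper bound displayed here for $\int_0^x u^{-\nu}\,\tilde t_{\mu+n,\nu+n}(u)\,du$ both hold with equality in place of strict inequality. All five inequalities displayed here are tight as $x\to\infty$, and the upper bound for $\int_0^x u^{-\nu}\,\tilde t_{\mu+n,\nu+n}(u)\,du$ (the one involving $c_{\mu,\nu,n}$ and $d_{\mu,\nu,n}$) is also tight as $x\downarrow0$.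
   Context: For real $\mu,\nu$ and $x>0$, the (normalized) modified Lommel function of the first kind is $$\tilde t_{\mu,\nu}(x)=\sum_{k=0}^\infty\frac{(\tfrac12x)^{\mu+2k+1}}{\Gamma\big(k+\frac{\mu-\nu+3}{2}\big)\Gamma\big(k+\frac{\mu+\nu+3}{2}\big)},$$ with the convention $1/\Gamma(z)=0$ when $z\in\{0,-1,-2,\ldots\}$. The lower incomplete gamma function is $\gamma(a,x)=\int_0^x u^{a-1}e^{-u}\,du$. Define the constants $$b_{\mu,\nu,n}=\frac{2\nu+n+1}{2^{\mu+n+2}(\mu-\nu+n+2)(\nu+n+1)\,\Gamma\big(\frac{\mu-\nu+1}{2}\big)\Gamma\big(\frac{\mu+\nu+2n+5}{2}\big)},$$ $$c_{\mu,\nu,n}=\frac{(2\nu+n+1)(2\nu+n+3)}{2^{\mu+n+4}(n+1)(\mu-\nu+n+4)(\nu+n+3)\,\Gamma\big(\frac{\mu-\nu+1}{2}\big)\Gamma\big(\frac{\mu+\nu+2n+9}{2}\big)},$$ $$d_{\mu,\nu,n}=\frac{2\nu+n+1}{2^{\mu+n+1}(n+1)(\mu-\nu+n+2)\,\Gamma\big(\frac{\mu-\nu+1}{2}\big)\Gamma\big(\frac{\mu+\nu+2n+5}{2}\big)}.$$ An inequality between two functions of $x$ is called tight in a limit ($x\downarrow0$ or $x\to\infty$) if, with all other parameters fixed, the ratio of its two sides tends to $1$ in that limit. *)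

theory Defs
  imports "HOL-Analysis.Analysis"
begin

text \<open>
  \<^const>\<open>rGamma\<close> is the entire reciprocal Gamma function, so the convention that the reciprocal
  of \<open>\<Gamma>\<close> vanishes at \<open>0, -1, -2, \<dots>\<close> is built in.
\<close>

definition lommel_t :: "real \<Rightarrow> real \<Rightarrow> real \<Rightarrow> real" where
  "lommel_t \<mu> \<nu> x =
     (\<Sum>k. (x / 2) powr (\<mu> + 2 * real k + 1)
            * rGamma (real k + (\<mu> - \<nu> + 3) / 2) * rGamma (real k + (\<mu> + \<nu> + 3) / 2))"

definition lower_Gamma :: "real \<Rightarrow> real \<Rightarrow> real" where
  "lower_Gamma a x = integral {0..x} (\<lambda>u. u powr (a - 1) * exp (- u))"

definition b_const :: "real \<Rightarrow> real \<Rightarrow> real \<Rightarrow> real" where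
  "b_const \<mu> \<nu> n =
     (2 * \<nu> + n + 1)
     / (2 powr (\<mu> + n + 2) * (\<mu> - \<nu> + n + 2) * (\<nu> + n + 1)
        * Gamma ((\<mu> - \<nu> + 1) / 2) * Gamma ((\<mu> + \<nu> + 2 * n + 5) / 2))"

definition c_const :: "real \<Rightarrow> real \<Rightarrow> real \<Rightarrow> real" where
  "c_const \<mu> \<nu> n =
     ((2 * \<nu> + n + 1) * (2 * \<nu> + n + 3))
     / (2 powr (\<mu> + n + 4) * (n + 1) * (\<mu> - \<nu> + n + 4) * (\<nu> + n + 3)
        * Gamma ((\<mu> - \<nu> + 1) / 2) * Gamma ((\<mu> + \<nu> + 2 * n + 9) / 2))"

definition d_const :: "real \<Rightarrow> real \<Rightarrow> real \<Rightarrow> real" where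
  "d_const \<mu> \<nu> n =
     (2 * \<nu> + n + 1)
     / (2 powr (\<mu> + n + 1) * (n + 1) * (\<mu> - \<nu> + n + 2)
        * Gamma ((\<mu> - \<nu> + 1) / 2) * Gamma ((\<mu> + \<nu> + 2 * n + 5) / 2))"

text \<open>
  The filter encodes the limit: \<^const>\<open>at_top\<close> for \<open>x \<rightarrow> \<infinity>\<close> and \<open>at_right 0\<close> for \<open>x \<down> 0\<close>.
\<close>

definition tight :: "(real \<Rightarrow> real) \<Rightarrow> (real \<Rightarrow> real) \<Rightarrow> real filter \<Rightarrow> bool" where
  "tight f g F \<longleftrightarrow> ((\<lambda>x. f x / g x) \<longlongrightarrow> 1) F"

end

theory Submission
  imports Defs
begin

text \<open>
  Write \<open>t\<^sub>j\<close> for \<open>t\<close> with both parameters raised by \<open>j\<close>. Termwise differentiation gives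
  \<open>t\<^sub>0' = (\<nu>/x) t\<^sub>0 + t\<^sub>1 + C x\<^sup>\<mu>\<close> with \<open>C > 0\<close>, and \<open>t\<^sub>1' = t\<^sub>0 - ((\<nu> + 1)/x) t\<^sub>1\<close>. Hence
  \<open>(e\<^sup>x x\<^bsup>\<nu>+1\<^esup> (t\<^sub>0 - t\<^sub>1))' = e\<^sup>x x\<^bsup>\<nu>+1\<^esup> ((2\<nu> + 1) t\<^sub>0/x + C x\<^sup>\<mu>)\<close>, which yields \<open>t\<^sub>1 < t\<^sub>0\<close> for \<open>\<nu> \<ge> -1/2\<close>
  and, by l'Hopital's rule, \<open>t\<^sub>1/t\<^sub>0 \<rightarrow> 1\<close> at infinity.

  Both sides of every inequality vanish as \<open>x \<down> 0\<close>, so an inequality (an equality when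
  \<open>2\<nu> + n = -1\<close>) follows by comparing derivatives, and its tightness follows by l'Hopital's rule
  from the ratio of the derivatives. For the upper bound the \<open>d\<close>-term cancels the inhomogeneous
  term of the three-term recurrence, and the difference of the derivatives is
  \<open>(2\<nu> + n + 1)(2\<nu> + n + 3) t\<^bsub>n+3\<^esub> / ((n + 1) x\<^bsup>\<nu>+1\<^esup>)\<close> plus the derivative of the \<open>c\<close>-term, which is
  positive and of higher order at \<open>0\<close>. The last inequality follows from the one before it and the first.
\<close>

section \<open>Derivatives of the Lommel function\<close>

text \<open>The power series left when \<open>(x / 2) powr (\<mu> + 1)\<close> is taken out of
  \<open>lommel_t\<close>, in the variable z = (x/2)^2. With a = (\<mu> - \<nu> + 1)/2 and s =
  (\<mu> + \<nu> + 3)/2, raising both parameters by one fixes a and raises s by one.\<close>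

definition lommel_series :: "real \<Rightarrow> real \<Rightarrow> real \<Rightarrow> real" where
  "lommel_series a s z = (\<Sum>k. rGamma (real k + a + 1) * rGamma (real k + s) * z ^ k)"

text \<open>Ratio test: by the functional equation of \<open>rGamma\<close>, each coefficient is (k
  + a + 1)(k + s) times the next one, a factor that is eventually at least 2|z|. Working with
  \<open>rGamma\<close> avoids any case distinction at the poles of Gamma.\<close>

lemma lommel_series_summable:
  "summable (\<lambda>k. rGamma (real k + a + 1) * rGamma (real k + s) * z ^ k)"
proof -
  \<comment> \<open>From this index on, k + a + 1 is at least 2|z| and k + s is at least 1.\<close>
  define N where "N = nat \<lceil>\<bar>a\<bar> + \<bar>s\<bar> + 2 * \<bar>z\<bar> + 2\<rceil>"
  show ?thesis
  proof (rule summable_ratio_test[of "1/2" N])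
    fix k assume "N \<le> k"
    hence k: "real k \<ge> \<bar>a\<bar> + \<bar>s\<bar> + 2 * \<bar>z\<bar> + 2"
      unfolding N_def by linarith
    define u v where "u = rGamma (real (Suc k) + a + 1)" and "v = rGamma (real (Suc k) + s)"
    have u: "rGamma (real k + a + 1) = (real k + a + 1) * u"
      using rGamma_plus1[of "real k + a + 1"] by (simp add: u_def add_ac)
    have v: "rGamma (real k + s) = (real k + s) * v"
      using rGamma_plus1[of "real k + s"] by (simp add: v_def add_ac)
    have "2 * \<bar>z\<bar> * 1 \<le> (real k + a + 1) * (real k + s)"
      using k by (intro mult_mono) auto
    hence z: "\<bar>z\<bar> \<le> 1/2 * \<bar>(real k + a + 1) * (real k + s)\<bar>"
      by linarith
    show "norm (u * v * z ^ Suc k) \<le> 1/2 * norm (rGamma (real k + a + 1) * rGamma (real k + s) * z ^ k)"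
      using mult_right_mono[OF z, of "\<bar>u * v * z ^ k\<bar>"] unfolding u v
      by (simp add: abs_mult mult_ac)
  qed simp
qed

text \<open>With c the coefficients, z D is the series with coefficients k c(k). Adding s - 1 or a
  times the original series turns k into k + s - 1 or k + a, which the functional equation absorbs
  into one of the two \<open>rGamma\<close> factors. In the second case the term k = 0 splits off
  and an index shift gives the series at s + 1; this split-off constant is the source of all
  inhomogeneous terms below.\<close>

lemma lommel_series_deriv:
  obtains D where "(lommel_series a s has_real_derivative D) (at z)"
    and "z * D + (s - 1) * lommel_series a s z = lommel_series a (s - 1) z"
    and "z * D + a * lommel_series a s z = rGamma a * rGamma s + z * lommel_series a (s + 1) z"
proof -
  define c where "c k = rGamma (real k + a + 1) * rGamma (real k + s)" for k
  define D where "D = (\<Sum>k. diffs c k * z ^ k)"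
  have sc: "summable (\<lambda>k. c k * y ^ k)" for y
    unfolding c_def by (rule lommel_series_summable)
  have "((\<lambda>x. \<Sum>k. c k * x ^ k) has_real_derivative D) (at z)"
    unfolding D_def by (rule termdiffs_strong_converges_everywhere) (rule sc)
  hence 1: "(lommel_series a s has_real_derivative D) (at z)"
    by (simp add: lommel_series_def[abs_def] c_def)
  have "summable (\<lambda>k. diffs c k * z ^ k)"
    by (rule termdiff_converges_all) (rule sc)
  hence "(\<lambda>k. real k * c k * z ^ (k - Suc 0)) sums D"
    unfolding D_def using diffs_equiv[of c z] by simp
  hence "(\<lambda>k. z * (real k * c k * z ^ (k - Suc 0))) sums (z * D)"
    by (rule sums_mult)
  moreover have "z * (real k * c k * z ^ (k - Suc 0)) = real k * c k * z ^ k" for k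
    by (cases k) auto
  ultimately have zD: "(\<lambda>k. real k * c k * z ^ k) sums (z * D)"
    by simp
  have L: "(\<lambda>k. c k * z ^ k) sums lommel_series a s z"
    using summable_sums[OF sc[of z]] by (simp add: lommel_series_def c_def)
  have "(\<lambda>k. real k * c k * z ^ k + (s - 1) * (c k * z ^ k)) sums
          (z * D + (s - 1) * lommel_series a s z)"
    by (intro sums_add zD sums_mult L)
  moreover have "real k * c k * z ^ k + (s - 1) * (c k * z ^ k)
      = rGamma (real k + a + 1) * rGamma (real k + (s - 1)) * z ^ k" for k
  proof -
    have *: "rGamma (real k + (s - 1)) = (real k + (s - 1)) * rGamma (real k + s)"
      using rGamma_plus1[of "real k + (s - 1)"] by simp
    show ?thesis unfolding * c_def by (simp add: algebra_simps)
  qed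
  ultimately have 2: "z * D + (s - 1) * lommel_series a s z = lommel_series a (s - 1) z"
    by (simp add: lommel_series_def sums_iff)
  have "(\<lambda>k. real k * c k * z ^ k + a * (c k * z ^ k)) sums (z * D + a * lommel_series a s z)"
    by (intro sums_add zD sums_mult L)
  moreover have "real k * c k * z ^ k + a * (c k * z ^ k)
      = rGamma (real k + a) * rGamma (real k + s) * z ^ k" for k
  proof -
    have "rGamma (real k + a) = (real k + a) * rGamma (real k + a + 1)"
      using rGamma_plus1[of "real k + a"] by simp
    thus ?thesis by (simp add: c_def algebra_simps)
  qed
  ultimately have s3: "(\<lambda>k. rGamma (real k + a) * rGamma (real k + s) * z ^ k) sums
      (z * D + a * lommel_series a s z)"
    by simp
  have "(\<lambda>k. rGamma (real (Suc k) + a) * rGamma (real (Suc k) + s) * z ^ Suc k) sums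
      (z * D + a * lommel_series a s z - rGamma a * rGamma s)"
    using s3 sums_Suc_iff[of "\<lambda>k. rGamma (real k + a) * rGamma (real k + s) * z ^ k"
        "z * D + a * lommel_series a s z - rGamma a * rGamma s"] by simp
  moreover have "(\<lambda>k. z * (rGamma (real k + a + 1) * rGamma (real k + (s + 1)) * z ^ k)) sums
      (z * lommel_series a (s + 1) z)"
    unfolding lommel_series_def by (intro sums_mult summable_sums lommel_series_summable)
  hence "(\<lambda>k. rGamma (real (Suc k) + a) * rGamma (real (Suc k) + s) * z ^ Suc k) sums
      (z * lommel_series a (s + 1) z)"
    by (simp add: algebra_simps)
  ultimately have "z * D + a * lommel_series a s z - rGamma a * rGamma s
      = z * lommel_series a (s + 1) z"
    by (rule sums_unique2)
  with 1 2 show thesis by (intro that[of D]) auto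
qed

section \<open>Positivity, lower bounds and continuity of the series\<close>

lemma rGamma_real_pos: "x > 0 \<Longrightarrow> rGamma x > 0" for x :: real
  by (simp add: rGamma_inverse_Gamma Gamma_real_pos)

lemma lommel_series_pos:
  assumes "a > -1" "s > 0" "z \<ge> 0"
  shows "lommel_series a s z > 0"
proof -
  have p: "rGamma (real k + a + 1) * rGamma (real k + s) > 0" for k
    using assms by (intro mult_pos_pos rGamma_real_pos) simp_all
  show ?thesis
    unfolding lommel_series_def
    using assms p[of 0] less_imp_le[OF p]
    by (intro suminf_pos2[of _ 0] lommel_series_summable) (auto intro!: mult_nonneg_nonneg[of "_ * _"])
qed

text \<open>All terms are nonnegative, so any one of them bounds the sum from below. The free choice
  of k later gives growth beyond every power of x.\<close>

lemma lommel_series_term_le: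
  assumes "a > -1" "s > 0" "z \<ge> 0"
  shows "rGamma (real k + a + 1) * rGamma (real k + s) * z ^ k \<le> lommel_series a s z"
proof -
  have p: "rGamma (real k + a + 1) * rGamma (real k + s) > 0" for k
    using assms by (intro mult_pos_pos rGamma_real_pos) simp_all
  have "(\<Sum>k\<in>{k}. rGamma (real k + a + 1) * rGamma (real k + s) * z ^ k) \<le> lommel_series a s z"
    unfolding lommel_series_def using assms p less_imp_le[OF p]
    by (intro sum_le_suminf lommel_series_summable) (auto intro!: mult_nonneg_nonneg[of "_ * _"])
  thus ?thesis by simp
qed

lemma continuous_on_lommel_series [continuous_intros]:
  assumes "continuous_on A f"
  shows "continuous_on A (\<lambda>x. lommel_series a s (f x))"
proof -
  have "isCont (lommel_series a s) z" for z
    using lommel_series_deriv[of a s z] by (metis DERIV_isCont)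
  hence "continuous_on UNIV (lommel_series a s)"
    by (simp add: continuous_at_imp_continuous_on)
  thus ?thesis
    using assms continuous_on_compose2 by blast
qed

section \<open>Differential relations and the three-term recurrence\<close>

lemma lommel_t_conv_series:
  assumes "x \<ge> 0"
  shows "lommel_t \<mu> \<nu> x = (x / 2) powr (\<mu> + 1) *
           lommel_series ((\<mu> - \<nu> + 1) / 2) ((\<mu> + \<nu> + 3) / 2) ((x / 2)\<^sup>2)"
proof -
  let ?a = "(\<mu> - \<nu> + 1) / 2" and ?s = "(\<mu> + \<nu> + 3) / 2"
  have "(x / 2) powr (\<mu> + 2 * real k + 1) * rGamma (real k + (\<mu> - \<nu> + 3) / 2)
          * rGamma (real k + (\<mu> + \<nu> + 3) / 2)
      = (x / 2) powr (\<mu> + 1) * (rGamma (real k + ?a + 1) * rGamma (real k + ?s) * ((x / 2)\<^sup>2) ^ k)" for k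
  \<comment> \<open>At x = 0 both sides vanish because \<open>0 powr r = 0\<close>. Covering this
    point makes the formula available for integrands on \<open>{0..x}\<close>.\<close>
  proof (cases "x = 0")
    case False
    have "(x / 2) powr (\<mu> + 2 * real k + 1) = (x / 2) powr (\<mu> + 1) * (x / 2) powr (real (2 * k))"
      unfolding powr_add[symmetric] by (simp add: add_ac)
    also have "(x / 2) powr (real (2 * k)) = ((x / 2)\<^sup>2) ^ k"
      using assms False by (subst powr_realpow) (auto simp: power_mult)
    finally have pw: "(x / 2) powr (\<mu> + 2 * real k + 1) = (x / 2) powr (\<mu> + 1) * ((x / 2)\<^sup>2) ^ k" .
    have "real k + (\<mu> - \<nu> + 3) / 2 = real k + ?a + 1" by (simp add: field_simps)
    thus ?thesis unfolding pw by (simp only: mult_ac)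
  qed simp
  thus ?thesis
    unfolding lommel_t_def lommel_series_def
    by (simp only:) (rule suminf_mult, rule lommel_series_summable)
qed

text \<open>Product and chain rule, with the derivative \<open>D\<close> of the series kept abstract
  so that either identity of \<open>lommel_series_deriv\<close> can be substituted for z D.\<close>

lemma lommel_t_has_derivative_aux:
  fixes x \<mu> \<nu> D :: real
  assumes "x > 0"
  defines "a \<equiv> (\<mu> - \<nu> + 1) / 2" and "s \<equiv> (\<mu> + \<nu> + 3) / 2"
  assumes D: "(lommel_series a s has_real_derivative D) (at ((x / 2)\<^sup>2))"
  shows "(lommel_t \<mu> \<nu> has_real_derivative
     2 / x * (x / 2) powr (\<mu> + 1) * ((\<mu> + 1) / 2 * lommel_series a s ((x / 2)\<^sup>2) + (x / 2)\<^sup>2 * D)) (at x)"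
proof -
  have D': "((\<lambda>x. lommel_series a s ((x / 2)\<^sup>2)) has_real_derivative D * (x / 2)) (at x)"
    by (rule DERIV_chain2[where g = "\<lambda>x. (x / 2)\<^sup>2", OF D])
       (auto intro!: derivative_eq_intros)
  have pw: "(x / 2) powr (\<mu> + 1) = x / 2 * (x / 2) powr \<mu>"
    "(x / 2) powr (1 + \<mu>) = x / 2 * (x / 2) powr \<mu>"
    using assms by (simp_all add: powr_add)
  have "((\<lambda>x. (x / 2) powr (\<mu> + 1) * lommel_series a s ((x / 2)\<^sup>2)) has_real_derivative
     2 / x * (x / 2) powr (\<mu> + 1) * ((\<mu> + 1) / 2 * lommel_series a s ((x / 2)\<^sup>2) + (x / 2)\<^sup>2 * D)) (at x)"
    using assms(1)
    by (auto intro!: derivative_eq_intros D') (simp add: pw field_simps power2_eq_square)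
  moreover have "\<forall>\<^sub>F y in nhds x. (y / 2) powr (\<mu> + 1) * lommel_series a s ((y / 2)\<^sup>2) = lommel_t \<mu> \<nu> y"
    using eventually_nhds_in_open[of "{0<..}" x] assms(1)
    by (auto elim!: eventually_mono simp: lommel_t_conv_series a_def s_def)
  ultimately show ?thesis
    by (subst (asm) DERIV_cong_ev[OF refl _ refl])
qed

text \<open>Uses the identity that raises s: subtracting a from (\<mu> + 1)/2 leaves \<nu>/2, and
  the split-off constant becomes the multiple of \<open>(x / 2) powr \<mu>\<close>.\<close>

lemma lommel_t_has_derivative:
  assumes "x > 0"
  shows "(lommel_t \<mu> \<nu> has_real_derivative \<nu> / x * lommel_t \<mu> \<nu> x + lommel_t (\<mu> + 1) (\<nu> + 1) x
           + (x / 2) powr \<mu> * rGamma ((\<mu> - \<nu> + 1) / 2) * rGamma ((\<mu> + \<nu> + 3) / 2)) (at x)"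
proof -
  let ?a = "(\<mu> - \<nu> + 1) / 2" and ?s = "(\<mu> + \<nu> + 3) / 2"
  define z where "z = (x / 2)\<^sup>2"
  obtain D where D: "(lommel_series ?a ?s has_real_derivative D) (at z)"
    and 2: "z * D + ?a * lommel_series ?a ?s z = rGamma ?a * rGamma ?s + z * lommel_series ?a (?s + 1) z"
    using lommel_series_deriv by metis
  have zD: "z * D = rGamma ?a * rGamma ?s + z * lommel_series ?a (?s + 1) z - ?a * lommel_series ?a ?s z"
    using 2 by simp
  have pw: "(x / 2) powr (\<mu> + 1) = x / 2 * (x / 2) powr \<mu>" "(x / 2) powr (\<mu> + 2) = z * (x / 2) powr \<mu>"
    using assms by (simp_all add: powr_add z_def)
  have T: "lommel_t \<mu> \<nu> x = (x / 2) powr (\<mu> + 1) * lommel_series ?a ?s z"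
    using assms by (simp add: lommel_t_conv_series z_def)
  have "(\<mu> + 1 - (\<nu> + 1) + 1) / 2 = ?a" "(\<mu> + 1 + (\<nu> + 1) + 3) / 2 = ?s + 1" "\<mu> + 1 + 1 = \<mu> + 2"
    by (simp_all add: field_simps)
  hence T1: "lommel_t (\<mu> + 1) (\<nu> + 1) x = (x / 2) powr (\<mu> + 2) * lommel_series ?a (?s + 1) z"
    using assms by (simp only: lommel_t_conv_series[of x] z_def)
  have "2 / x * (x / 2) powr (\<mu> + 1) * ((\<mu> + 1) / 2 * lommel_series ?a ?s z + z * D)
      = \<nu> / x * lommel_t \<mu> \<nu> x + lommel_t (\<mu> + 1) (\<nu> + 1) x + (x / 2) powr \<mu> * rGamma ?a * rGamma ?s"
    using assms unfolding zD T T1 pw by (simp add: field_simps)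
  thus ?thesis
    using lommel_t_has_derivative_aux[OF assms D[unfolded z_def]] by (simp add: z_def)
qed

text \<open>Uses the identity that lowers s, at raised parameters, so that the lowered series
  belongs to the original parameters. No inhomogeneous term appears this way.\<close>

lemma lommel_t_Suc_has_derivative:
  assumes "x > 0"
  shows "(lommel_t (\<mu> + 1) (\<nu> + 1) has_real_derivative
           lommel_t \<mu> \<nu> x - (\<nu> + 1) / x * lommel_t (\<mu> + 1) (\<nu> + 1) x) (at x)"
proof -
  let ?a = "(\<mu> + 1 - (\<nu> + 1) + 1) / 2" and ?s = "(\<mu> + 1 + (\<nu> + 1) + 3) / 2"
  define z where "z = (x / 2)\<^sup>2"
  obtain D where D: "(lommel_series ?a ?s has_real_derivative D) (at z)"
    and 2: "z * D + (?s - 1) * lommel_series ?a ?s z = lommel_series ?a (?s - 1) z"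
    using lommel_series_deriv by metis
  have zD: "z * D = lommel_series ?a (?s - 1) z - (?s - 1) * lommel_series ?a ?s z"
    using 2 by simp
  have pw: "(x / 2) powr (\<mu> + 1 + 1) = x / 2 * (x / 2) powr (\<mu> + 1)"
    using assms powr_add[of "x/2" "\<mu> + 1" 1] by simp
  have T1: "lommel_t (\<mu> + 1) (\<nu> + 1) x = (x / 2) powr (\<mu> + 1 + 1) * lommel_series ?a ?s z"
    using assms by (simp add: lommel_t_conv_series z_def)
  have "(\<mu> - \<nu> + 1) / 2 = ?a" "(\<mu> + \<nu> + 3) / 2 = ?s - 1"
    by (simp_all add: field_simps)
  hence T: "lommel_t \<mu> \<nu> x = (x / 2) powr (\<mu> + 1) * lommel_series ?a (?s - 1) z"
    using assms by (simp only: lommel_t_conv_series[of x] z_def)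
  have "2 / x * (x / 2) powr (\<mu> + 1 + 1) * ((\<mu> + 1 + 1) / 2 * lommel_series ?a ?s z + z * D)
      = lommel_t \<mu> \<nu> x - (\<nu> + 1) / x * lommel_t (\<mu> + 1) (\<nu> + 1) x"
    using assms unfolding zD T T1 pw by (simp add: field_simps)
  thus ?thesis
    using lommel_t_has_derivative_aux[OF assms D[unfolded z_def]] by (simp add: z_def)
qed

text \<open>The two derivative formulas, both taken at the parameters \<mu> + 1 and \<nu> + 1, must
  agree.\<close>

lemma lommel_t_recurrence:
  assumes "x > 0"
  shows "lommel_t \<mu> \<nu> x = 2 * (\<nu> + 1) / x * lommel_t (\<mu> + 1) (\<nu> + 1) x + lommel_t (\<mu> + 2) (\<nu> + 2) x
           + (x / 2) powr (\<mu> + 1) * rGamma ((\<mu> - \<nu> + 1) / 2) * rGamma ((\<mu> + \<nu> + 5) / 2)"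
  using DERIV_unique[OF lommel_t_Suc_has_derivative[OF assms]
      lommel_t_has_derivative[OF assms, of "\<mu> + 1" "\<nu> + 1"]] assms
  by (simp add: field_simps)

section \<open>Comparing functions through their derivatives\<close>

text \<open>D increases on the positive axis, so its limit at 0 is at most D(x/2), which is less
  than D(x). The intermediate point keeps the inequality strict.\<close>

lemma tendsto_0_at_right_imp_pos:
  fixes D D' :: "real \<Rightarrow> real"
  assumes deriv: "\<And>x. x > 0 \<Longrightarrow> (D has_real_derivative D' x) (at x)"
    and pos: "\<And>x. x > 0 \<Longrightarrow> D' x > 0"
    and lim: "(D \<longlongrightarrow> 0) (at_right 0)" and "x > 0"
  shows "D x > 0"
proof -
  have less: "D y < D z" if "0 < y" "y < z" for y z
  proof (rule DERIV_pos_imp_increasing[OF that(2)])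
    fix t assume "y \<le> t"
    with that have "t > 0" by simp
    thus "\<exists>d. (D has_real_derivative d) (at t) \<and> 0 < d"
      using deriv pos by blast
  qed
  have "D (x / 2) \<ge> 0"
  proof (rule tendsto_upperbound[OF lim])
    show "\<forall>\<^sub>F y in at_right 0. D y \<le> D (x / 2)"
      by (rule eventually_at_rightI[of 0 "x/2"])
         (use \<open>x > 0\<close> in \<open>auto intro!: less_imp_le[OF less]\<close>)
  qed simp
  also have "D (x / 2) < D x"
    using \<open>x > 0\<close> by (intro less) auto
  finally show ?thesis .
qed

lemma tendsto_0_at_right_imp_eq_0:
  fixes D :: "real \<Rightarrow> real"
  assumes deriv: "\<And>x. x > 0 \<Longrightarrow> (D has_real_derivative 0) (at x)"
    and lim: "(D \<longlongrightarrow> 0) (at_right 0)" and "x > 0"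
  shows "D x = 0"
proof -
  have "\<exists>c. \<forall>y\<in>{0<..}. D y = c"
    by (rule has_field_derivative_zero_constant) (auto intro!: has_field_derivative_at_within[OF deriv])
  then obtain c where c: "\<And>y. y > 0 \<Longrightarrow> D y = c"
    by auto
  have "\<forall>\<^sub>F y in at_right 0. c = D y"
    using c by (intro eventually_at_rightI[of 0 1]) auto
  hence "(D \<longlongrightarrow> c) (at_right 0)"
    by (rule tendsto_cong[THEN iffD1, OF _ tendsto_const])
  with lim have "c = 0"
    by (intro tendsto_unique) auto
  with c \<open>x > 0\<close> show ?thesis by simp
qed

text \<open>For e < 0 the integrand may be unbounded at 0, so integrability comes from an absolutely
  integrable power times a bounded continuous factor. The derivative at x > 0 then needs continuity
  of \<open>\<phi>\<close> at x alone, and the limit at 0 is continuity of the indefinite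
  integral.\<close>

lemma
  fixes \<phi> G :: "real \<Rightarrow> real"
  assumes e: "e > -1" and G: "continuous_on UNIV G"
    and \<phi>: "\<And>u. u \<ge> 0 \<Longrightarrow> \<phi> u = u powr e * G u"
  shows has_real_derivative_integral_powr_mult:
      "x > 0 \<Longrightarrow> ((\<lambda>x. integral {0..x} \<phi>) has_real_derivative \<phi> x) (at x)"
    and tendsto_integral_powr_mult: "((\<lambda>x. integral {0..x} \<phi>) \<longlongrightarrow> 0) (at_right 0)"
proof -
  have intble: "\<phi> integrable_on {0..b}" if "b \<ge> 0" for b
  proof -
    have "(\<lambda>u. u powr e) absolutely_integrable_on {0..b}"
      using that e by (intro nonnegative_absolutely_integrable_1 integrable_on_powr_from_0) auto
    moreover have c: "continuous_on {0..b} G"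
      using G by (rule continuous_on_subset) auto
    moreover have "G \<in> borel_measurable (lebesgue_on {0..b})"
      using c by (rule continuous_imp_measurable_on_sets_lebesgue) simp
    moreover have "bounded (G ` {0..b})"
      using c by (intro compact_imp_bounded compact_continuous_image) simp_all
    ultimately have "(\<lambda>u. G u * u powr e) absolutely_integrable_on {0..b}"
      by (intro absolutely_integrable_bounded_measurable_product_real) simp_all
    hence "(\<lambda>u. G u * u powr e) integrable_on {0..b}"
      by (simp add: absolutely_integrable_on_def)
    thus ?thesis
      by (rule integrable_eq) (simp add: \<phi> mult.commute)
  qed
  show "((\<lambda>x. integral {0..x} \<phi>) \<longlongrightarrow> 0) (at_right 0)"
  proof -
    have "continuous_on {0..1} (\<lambda>x. integral {0..x} \<phi>)"
      by (intro indefinite_integral_continuous_1 intble) auto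
    hence "((\<lambda>x. integral {0..x} \<phi>) \<longlongrightarrow> integral {0..0} \<phi>) (at 0 within {0..1})"
      unfolding continuous_on_def by (rule bspec) simp
    thus ?thesis
      by (simp add: at_within_Icc_at_right)
  qed
  assume "x > 0"
  have "isCont G x"
    using G by (simp add: continuous_on_eq_continuous_at)
  hence "isCont (\<lambda>u. u powr e * G u) x"
    using \<open>x > 0\<close> by (intro continuous_intros) simp_all
  moreover have "\<forall>\<^sub>F u in nhds x. u powr e * G u = \<phi> u"
    by (rule eventually_mono[OF eventually_nhds_in_open[of "{0<..}" x]])
       (use \<open>x > 0\<close> \<phi> in simp_all)
  ultimately have "isCont \<phi> x"
    by (rule isCont_cong[THEN iffD1, rotated])
  \<comment> \<open>Within \<open>{0..x+1}\<close> the point x is interior, so the derivative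
    obtained there is the full one. The empty exceptional set matches the form of the library
    rule.\<close>
  hence "continuous (at x within ({0..x+1} - {})) \<phi>"
    by (rule continuous_at_imp_continuous_at_within)
  hence "((\<lambda>u. integral {0..u} \<phi>) has_vector_derivative \<phi> x) (at x within ({0..x+1} - {}))"
    using \<open>x > 0\<close>
    by (intro integral_has_vector_derivative_continuous_at intble)
       simp_all
  moreover have "at x within ({0..x+1} - {}) = at x"
    using \<open>x > 0\<close> by (simp add: at_within_Icc_at)
  ultimately show "((\<lambda>x. integral {0..x} \<phi>) has_real_derivative \<phi> x) (at x)"
    by (simp add: has_real_derivative_iff_has_vector_derivative)
qed

section \<open>Limits of quotients by l'Hopital's rule\<close>

lemma filterlim_at_top_if_deriv_at_top:
  fixes G G' :: "real \<Rightarrow> real"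
  assumes deriv: "\<And>x. x > 0 \<Longrightarrow> (G has_real_derivative G' x) (at x)"
    and lim: "filterlim G' at_top at_top"
  shows "filterlim G at_top at_top"
proof -
  have "\<forall>\<^sub>F x in at_top. G' x \<ge> 1"
    using lim by (simp add: filterlim_at_top)
  then obtain X0 where X0: "\<And>x. x \<ge> X0 \<Longrightarrow> G' x \<ge> 1"
    unfolding eventually_at_top_linorder by blast
  define X where "X = max X0 1"
  have X: "X > 0" "\<And>x. x \<ge> X \<Longrightarrow> G' x \<ge> 1"
    using X0 by (simp_all add: X_def)
  \<comment> \<open>Where G' is at least 1, G(y) - y is nondecreasing, so G grows at least
    linearly.\<close>
  have "G x - x \<ge> G X - X" if "x \<ge> X" for x
  proof (rule DERIV_nonneg_imp_nondecreasing[OF that])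
    fix y assume "X \<le> y"
    with X show "\<exists>d. ((\<lambda>y. G y - y) has_real_derivative d) (at y) \<and> 0 \<le> d"
      by (intro exI[of _ "G' y - 1"]) (auto intro!: derivative_eq_intros deriv)
  qed
  hence "\<forall>\<^sub>F x in at_top. (G X - X) + x \<le> G x"
    by (intro eventually_mono[OF eventually_ge_at_top[of X]]) (force simp: algebra_simps)
  moreover have "filterlim (\<lambda>x. (G X - X) + x) at_top at_top"
    by (intro filterlim_tendsto_add_at_top[OF tendsto_const] filterlim_ident)
  ultimately show ?thesis
    by (rule filterlim_at_top_mono[rotated])
qed

lemma tight_if_tendsto_inverse:
  "((\<lambda>x. g x / f x) \<longlongrightarrow> 1) F \<Longrightarrow> tight f g F"
  using tendsto_inverse[of "\<lambda>x. g x / f x" 1 F] by (simp add: tight_def)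

text \<open>l'Hopital's rule is applied to R/G rather than G/R, because G is the function whose
  divergence can be read off from its derivative.\<close>

lemma tight_at_topI:
  assumes G: "\<And>x. x > 0 \<Longrightarrow> (G has_real_derivative G' x) (at x)"
    and R: "\<And>x. x > 0 \<Longrightarrow> (R has_real_derivative R' x) (at x)"
    and top: "filterlim G' at_top at_top"
    and lim: "((\<lambda>x. R' x / G' x) \<longlongrightarrow> 1) at_top"
  shows "tight G R at_top"
proof (rule tight_if_tendsto_inverse, rule lhospital_at_top_at_top)
  show "filterlim G at_top at_top"
    using G top by (rule filterlim_at_top_if_deriv_at_top)
  have "\<forall>\<^sub>F x in at_top. G' x > 0"
    using top by (simp add: filterlim_at_top_dense)
  thus "\<forall>\<^sub>F x in at_top. G' x \<noteq> 0"
    by eventually_elim simp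
qed (use lim in \<open>auto intro!: eventually_mono[OF eventually_gt_at_top[of 0]] G R\<close>)

text \<open>Positivity of G' makes G positive as well, so neither denominator in l'Hopital's rule
  vanishes.\<close>

lemma tight_at_right_0I:
  assumes G: "\<And>x. x > 0 \<Longrightarrow> (G has_real_derivative G' x) (at x)"
    and R: "\<And>x. x > 0 \<Longrightarrow> (R has_real_derivative R' x) (at x)"
    and pos: "\<And>x. x > 0 \<Longrightarrow> G' x > 0"
    and 0: "(G \<longlongrightarrow> 0) (at_right 0)" "(R \<longlongrightarrow> 0) (at_right 0)"
    and lim: "((\<lambda>x. R' x / G' x) \<longlongrightarrow> 1) (at_right 0)"
  shows "tight G R (at_right 0)"
proof (rule tight_if_tendsto_inverse, rule lhopital_right_0[OF 0(2,1)])
  have ev: "\<forall>\<^sub>F x in at_right 0. P x" if "\<And>x. x > 0 \<Longrightarrow> P x" for P :: "real \<Rightarrow> bool"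
    using that by (intro eventually_at_rightI[of 0 1]) auto
  show "\<forall>\<^sub>F x in at_right 0. G x \<noteq> 0"
    using tendsto_0_at_right_imp_pos[OF G pos 0(1)] by (intro ev) force
  show "\<forall>\<^sub>F x in at_right 0. G' x \<noteq> 0"
    using pos by (intro ev) force
qed (use lim in \<open>auto intro!: eventually_at_rightI[of 0 1] G R\<close>)

text \<open>A logarithmic derivative tending to 1 eventually exceeds \<beta> + \<delta>, so
  \<open>\<psi>\<close> is eventually nondecreasing and bounded below by a positive constant. The
  remaining factor \<open>exp (\<delta> * x)\<close> diverges.\<close>

lemma exp_mult_at_top_if_log_deriv:
  fixes \<phi> \<phi>' :: "real \<Rightarrow> real"
  assumes deriv: "\<And>x. x > 0 \<Longrightarrow> (\<phi> has_real_derivative \<phi>' x) (at x)"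
    and pos: "\<And>x. x > 0 \<Longrightarrow> \<phi> x > 0"
    and lim: "((\<lambda>x. \<phi>' x / \<phi> x) \<longlongrightarrow> 1) at_top" and "\<beta> < 1"
  shows "filterlim (\<lambda>x. exp (- \<beta> * x) * \<phi> x) at_top at_top"
proof -
  \<comment> \<open>Half the gap between \<beta> and 1, which keeps both \<delta> > 0 and \<beta> +
    \<delta> < 1.\<close>
  define \<delta> where "\<delta> = (1 - \<beta>) / 2"
  have \<delta>: "\<delta> > 0" "\<beta> + \<delta> < 1"
    using \<open>\<beta> < 1\<close> by (auto simp: \<delta>_def field_simps)
  define \<psi> where "\<psi> x = exp (- (\<beta> + \<delta>) * x) * \<phi> x" for x
  have "\<forall>\<^sub>F x in at_top. \<phi>' x / \<phi> x > \<beta> + \<delta>"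
    using lim \<delta>(2) by (rule order_tendstoD)
  then obtain X0 where X0: "\<And>x. x \<ge> X0 \<Longrightarrow> \<phi>' x / \<phi> x > \<beta> + \<delta>"
    unfolding eventually_at_top_linorder by blast
  define X where "X = max X0 1"
  have X: "X > 0" "\<And>x. x \<ge> X \<Longrightarrow> \<phi>' x / \<phi> x > \<beta> + \<delta>"
    using X0 by (simp_all add: X_def)
  have "\<psi> x \<ge> \<psi> X" if "x \<ge> X" for x
  proof (rule DERIV_nonneg_imp_nondecreasing[OF that])
    fix y assume y: "X \<le> y"
    with X have "y > 0" by simp
    have "\<phi>' y \<ge> (\<beta> + \<delta>) * \<phi> y"
      using X(2)[OF y] pos[OF \<open>y > 0\<close>] by (simp add: field_simps)
    moreover have "(\<psi> has_real_derivative exp (- (\<beta> + \<delta>) * y) * (\<phi>' y - (\<beta> + \<delta>) * \<phi> y)) (at y)"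
      unfolding \<psi>_def
      by (rule derivative_eq_intros deriv \<open>y > 0\<close> refl)+ (simp add: algebra_simps)
    ultimately show "\<exists>d. (\<psi> has_real_derivative d) (at y) \<and> 0 \<le> d"
      by (intro exI conjI) auto
  qed
  moreover have "exp (\<delta> * x) * \<psi> x = exp (- \<beta> * x) * \<phi> x" for x
    by (simp add: \<psi>_def exp_add[symmetric] mult.assoc[symmetric]) (simp add: algebra_simps)
  ultimately have "exp (\<delta> * x) * \<psi> X \<le> exp (- \<beta> * x) * \<phi> x" if "x \<ge> X" for x
    using that by (metis exp_ge_zero mult_left_mono)
  hence "\<forall>\<^sub>F x in at_top. exp (\<delta> * x) * \<psi> X \<le> exp (- \<beta> * x) * \<phi> x"
    by (intro eventually_mono[OF eventually_ge_at_top[of X]])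
  moreover have "filterlim (\<lambda>x. exp (\<delta> * x) * \<psi> X) at_top at_top"
  proof (rule filterlim_at_top_mult_tendsto_pos[OF tendsto_const])
    show "\<psi> X > 0" using X pos by (simp add: \<psi>_def)
    show "filterlim (\<lambda>x. exp (\<delta> * x)) at_top at_top"
      using \<delta> by (intro filterlim_compose[OF exp_at_top]
          filterlim_tendsto_pos_mult_at_top[OF tendsto_const] filterlim_ident)
  qed
  ultimately show ?thesis
    by (rule filterlim_at_top_mono[rotated])
qed

section \<open>Growth of the Lommel function\<close>

lemma tendsto_powr_at_right_0:
  fixes e :: real
  assumes "e > 0"
  shows "((\<lambda>x. x powr e) \<longlongrightarrow> 0) (at_right 0)"
proof -
  have "((\<lambda>x::real. x powr e) \<longlongrightarrow> 0 powr e) (at_right 0)"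
    using assms by (intro tendsto_powr2 tendsto_const tendsto_ident_at)
      (auto intro!: eventually_at_rightI[of 0 1])
  thus ?thesis by simp
qed

lemma lommel_t_pos:
  assumes "\<mu> - \<nu> + 3 > 0" "\<mu> + \<nu> + 3 > 0" "x > 0"
  shows "lommel_t \<mu> \<nu> x > 0"
  using assms by (simp add: lommel_t_conv_series lommel_series_pos)

text \<open>The quotient is x^(\<mu> + 1 - r) times a continuous function. The vanishing case
  supplies zero initial values for the comparison arguments; the critical exponent supplies the
  leading coefficient for tightness at 0.\<close>

lemma lommel_t_tendsto_at_right_0:
  assumes "r \<le> \<mu> + 1"
  shows "((\<lambda>x. lommel_t \<mu> \<nu> x / x powr r) \<longlongrightarrow>
     (if r < \<mu> + 1 then 0 else rGamma ((\<mu> - \<nu> + 3) / 2) * rGamma ((\<mu> + \<nu> + 3) / 2) / 2 powr (\<mu> + 1)))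
     (at_right 0)"
proof -
  let ?L = "\<lambda>x. lommel_series ((\<mu> - \<nu> + 1) / 2) ((\<mu> + \<nu> + 3) / 2) ((x / 2)\<^sup>2)"
  define P where "P = (\<lambda>x::real. if r < \<mu> + 1 then x powr (\<mu> + 1 - r) else 1)"
  have "isCont ?L 0"
    using continuous_on_eq_continuous_at[of UNIV ?L]
    by (auto intro!: continuous_intros)
  hence L: "(?L \<longlongrightarrow> ?L 0) (at_right 0)"
    by (simp add: isCont_def filterlim_at_split)
  have "(P \<longlongrightarrow> (if r < \<mu> + 1 then 0 else 1)) (at_right 0)"
  proof (cases "r < \<mu> + 1")
    case True
    thus ?thesis using tendsto_powr_at_right_0[of "\<mu> + 1 - r"] by (simp add: P_def)
  qed (simp add: P_def)
  hence lim: "((\<lambda>x. P x * ?L x / 2 powr (\<mu> + 1)) \<longlongrightarrow>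
      (if r < \<mu> + 1 then 0 else 1) * ?L 0 / 2 powr (\<mu> + 1)) (at_right 0)"
    by (intro tendsto_intros L) auto
  have L0: "?L 0 = rGamma ((\<mu> - \<nu> + 3) / 2) * rGamma ((\<mu> + \<nu> + 3) / 2)"
  proof -
    have *: "(\<mu> - \<nu> + 1) / 2 + 1 = (\<mu> - \<nu> + 3) / 2" by (simp add: field_simps)
    show ?thesis by (simp add: lommel_series_def *)
  qed
  have "P x * ?L x / 2 powr (\<mu> + 1) = lommel_t \<mu> \<nu> x / x powr r" if "x > 0" for x
  proof -
    have "P x = x powr (\<mu> + 1) / x powr r"
      using assms that by (auto simp: P_def powr_diff)
    thus ?thesis
      using that by (simp add: lommel_t_conv_series powr_divide)
  qed
  hence ev: "\<forall>\<^sub>F x in at_right 0. P x * ?L x / 2 powr (\<mu> + 1) = lommel_t \<mu> \<nu> x / x powr r"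
    by (intro eventually_at_rightI[of 0 1]) auto
  show ?thesis
    using Lim_transform_eventually[OF lim ev] unfolding L0 by (cases "r < \<mu> + 1") simp_all
qed

text \<open>A single term of the series, of sufficiently large index, already dominates a multiple
  of x.\<close>

lemma lommel_t_over_powr_at_top:
  assumes "\<mu> - \<nu> + 3 > 0" "\<mu> + \<nu> + 3 > 0"
  shows "filterlim (\<lambda>x. lommel_t \<mu> \<nu> x / x powr r) at_top at_top"
proof -
  let ?a = "(\<mu> - \<nu> + 1) / 2" and ?s = "(\<mu> + \<nu> + 3) / 2"
  have as: "?a > -1" "?s > 0" using assms by auto
  \<comment> \<open>This index makes the exponent \<open>e\<close>, left after division by
    \<open>x powr r\<close>, at least 1.\<close>
  define k where "k = nat \<lceil>\<bar>r\<bar> + \<bar>\<mu>\<bar>\<rceil>"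
  define e where "e = \<mu> + 1 + 2 * real k - r"
  define c where "c = rGamma (real k + ?a + 1) * rGamma (real k + ?s) / 2 powr (\<mu> + 1 + 2 * real k)"
  have "real k \<ge> \<bar>r\<bar> + \<bar>\<mu>\<bar>" unfolding k_def by linarith
  hence e: "e \<ge> 1" unfolding e_def by linarith
  have c: "c > 0"
  proof -
    have "real k + ?a + 1 > 0" "real k + ?s > 0"
      using as of_nat_0_le_iff[of k] by linarith+
    thus ?thesis
      unfolding c_def by (intro divide_pos_pos mult_pos_pos rGamma_real_pos) auto
  qed
  have "c * x \<le> lommel_t \<mu> \<nu> x / x powr r" if "x \<ge> 1" for x
  proof -
    have "x > 0" using that by simp
    have "c * x powr 1 \<le> c * x powr e"
      using c e that by (intro mult_left_mono powr_mono) auto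
    moreover
    have *: "(x / 2) powr (\<mu> + 1) * (rGamma (real k + ?a + 1) * rGamma (real k + ?s) * ((x / 2)\<^sup>2) ^ k)
        \<le> lommel_t \<mu> \<nu> x"
      using as unfolding lommel_t_conv_series[OF less_imp_le[OF \<open>x > 0\<close>]]
      by (intro mult_left_mono lommel_series_term_le) auto
    have "((x / 2)\<^sup>2) ^ k = (x / 2) powr (real (2 * k))"
      using \<open>x > 0\<close> by (subst powr_realpow) (auto simp: power_mult)
    with * have "(x / 2) powr (\<mu> + 1 + 2 * real k) * (rGamma (real k + ?a + 1) * rGamma (real k + ?s))
        \<le> lommel_t \<mu> \<nu> x"
      by (simp add: powr_add mult_ac)
    hence "x powr (\<mu> + 1 + 2 * real k) * c \<le> lommel_t \<mu> \<nu> x"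
      using that by (simp add: c_def powr_divide)
    hence "c * x powr e \<le> lommel_t \<mu> \<nu> x / x powr r"
      using \<open>x > 0\<close> by (simp add: e_def powr_diff field_simps)
    ultimately show ?thesis
      using \<open>x > 0\<close> by simp
  qed
  hence "\<forall>\<^sub>F x in at_top. c * x \<le> lommel_t \<mu> \<nu> x / x powr r"
    by (intro eventually_mono[OF eventually_ge_at_top[of 1]])
  moreover have "filterlim (\<lambda>x. c * x) at_top at_top"
    using c by (intro filterlim_tendsto_pos_mult_at_top[OF tendsto_const] filterlim_ident)
  ultimately show ?thesis
    by (rule filterlim_at_top_mono[rotated])
qed

lemma powr_over_lommel_t_tendsto_0:
  assumes "\<mu> - \<nu> + 3 > 0" "\<mu> + \<nu> + 3 > 0"
  shows "((\<lambda>x. x powr r / lommel_t \<mu> \<nu> x) \<longlongrightarrow> 0) at_top"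
  using tendsto_inverse_0_at_top[OF lommel_t_over_powr_at_top[OF assms, of r]] by simp

section \<open>Comparison of neighbouring Lommel functions\<close>

lemma exp_powr_has_derivative:
  fixes x r :: real
  assumes "x > 0"
  shows "((\<lambda>x. exp x * x powr r) has_real_derivative exp x * x powr r * (1 + r / x)) (at x)"
proof -
  have "x powr (r - 1) = x powr r / x"
    using assms by (simp add: powr_diff)
  thus ?thesis
    by (intro DERIV_cong[OF DERIV_mult[OF DERIV_exp has_real_derivative_powr[OF assms]]])
       (simp add: algebra_simps)
qed

text \<open>With t the function at (\<mu>, \<nu>) and K its inhomogeneous term, the difference y of
  neighbours satisfies y' = -(1 + (\<nu> + 1)/x) y + (2\<nu> + 1) t/x + K. The weight is the
  integrating factor of this equation.\<close>

lemma exp_powr_lommel_t_diff_has_derivative: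
  assumes "x > 0"
  shows "((\<lambda>x. exp x * x powr (\<nu> + 1) * (lommel_t \<mu> \<nu> x - lommel_t (\<mu> + 1) (\<nu> + 1) x))
      has_real_derivative exp x * x powr (\<nu> + 1) * ((2 * \<nu> + 1) / x * lommel_t \<mu> \<nu> x
        + (x / 2) powr \<mu> * rGamma ((\<mu> - \<nu> + 1) / 2) * rGamma ((\<mu> + \<nu> + 3) / 2))) (at x)"
proof -
  have alg: "E * (1 + (\<nu> + 1) / x) * (F - G) + (\<nu> / x * F + G + K - (F - (\<nu> + 1) / x * G)) * E
      = E * ((2 * \<nu> + 1) / x * F + K)" for E F G K :: real
    by (simp add: algebra_simps add_divide_distrib diff_divide_distrib)
  show ?thesis
    by (rule DERIV_cong[OF DERIV_mult[OF exp_powr_has_derivative DERIV_diff[OF lommel_t_has_derivative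
          lommel_t_Suc_has_derivative]]]) (use assms in \<open>simp_all only: alg\<close>)
qed

text \<open>The weighted difference vanishes at 0 because \<mu> + \<nu> + 2 > 0. In its derivative
  the first summand is nonnegative by \<nu> \<ge> - 1/2 and the second is positive.\<close>

lemma lommel_t_Suc_less:
  assumes "\<nu> \<ge> - 1 / 2" "\<nu> < \<mu> + 1" "\<mu> + \<nu> + 2 > 0" "x > 0"
  shows "lommel_t (\<mu> + 1) (\<nu> + 1) x < lommel_t \<mu> \<nu> x"
proof -
  let ?D = "\<lambda>x. exp x * x powr (\<nu> + 1) * (lommel_t \<mu> \<nu> x - lommel_t (\<mu> + 1) (\<nu> + 1) x)"
  \<comment> \<open>The power in the weight is written as a division by
    \<open>x powr (- (\<nu> + 1))\<close> to fit the limit lemma at 0.\<close>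
  have "((\<lambda>x. exp x * (lommel_t \<mu> \<nu> x / x powr (- (\<nu> + 1))
            - lommel_t (\<mu> + 1) (\<nu> + 1) x / x powr (- (\<nu> + 1)))) \<longlongrightarrow>
          exp 0 * (0 - 0)) (at_right 0)"
    using assms lommel_t_tendsto_at_right_0[of "- (\<nu> + 1)" "\<mu>" \<nu>]
      lommel_t_tendsto_at_right_0[of "- (\<nu> + 1)" "\<mu> + 1" "\<nu> + 1"]
    by (intro tendsto_intros) auto
  moreover have "(\<lambda>x. exp x * (lommel_t \<mu> \<nu> x / x powr (- (\<nu> + 1))
            - lommel_t (\<mu> + 1) (\<nu> + 1) x / x powr (- (\<nu> + 1)))) = ?D"
    unfolding powr_minus by (auto simp: field_simps)
  ultimately have lim: "(?D \<longlongrightarrow> 0) (at_right 0)" by simp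
  have "?D x > 0"
  proof (rule tendsto_0_at_right_imp_pos[OF exp_powr_lommel_t_diff_has_derivative _ lim \<open>x > 0\<close>])
    fix y :: real assume "y > 0"
    have "(2 * \<nu> + 1) / y * lommel_t \<mu> \<nu> y \<ge> 0"
      using assms \<open>y > 0\<close> lommel_t_pos[of \<mu> \<nu> y] by (intro mult_nonneg_nonneg) auto
    moreover have "(y / 2) powr \<mu> * rGamma ((\<mu> - \<nu> + 1) / 2) * rGamma ((\<mu> + \<nu> + 3) / 2) > 0"
      using assms \<open>y > 0\<close> by (intro mult_pos_pos rGamma_real_pos) auto
    ultimately show "exp y * y powr (\<nu> + 1) * ((2 * \<nu> + 1) / y * lommel_t \<mu> \<nu> y
        + (y / 2) powr \<mu> * rGamma ((\<mu> - \<nu> + 1) / 2) * rGamma ((\<mu> + \<nu> + 3) / 2)) > 0"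
      using \<open>y > 0\<close> by (intro mult_pos_pos[of "exp y * _"] add_nonneg_pos) auto
  qed auto
  moreover have "exp x * x powr (\<nu> + 1) > 0"
    using \<open>x > 0\<close> by simp
  ultimately have "lommel_t \<mu> \<nu> x - lommel_t (\<mu> + 1) (\<nu> + 1) x > 0"
    by (rule zero_less_mult_pos)
  thus ?thesis by simp
qed

text \<open>l'Hopital's rule for N/D = 1 - g/f, where N and D carry the same weight. The derivatives
  have the quotient q/(1 + q + g/f); since q tends to 0 and g/f is positive, this tends to 0 without
  prior knowledge of the limit of g/f.\<close>

lemma lommel_t_Suc_ratio:
  assumes "\<nu> < \<mu> + 1" "\<mu> + \<nu> + 3 > 0"
  shows "((\<lambda>x. lommel_t (\<mu> + 1) (\<nu> + 1) x / lommel_t \<mu> \<nu> x) \<longlongrightarrow> 1) at_top"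
proof -
  let ?f = "lommel_t \<mu> \<nu>" and ?g = "lommel_t (\<mu> + 1) (\<nu> + 1)"
  let ?k = "rGamma ((\<mu> - \<nu> + 1) / 2) * rGamma ((\<mu> + \<nu> + 3) / 2)"
  let ?N = "\<lambda>x. exp x * x powr (\<nu> + 1) * (?f x - ?g x)"
  let ?D = "\<lambda>x. exp x * x powr (\<nu> + 1) * ?f x"
  \<comment> \<open>This is N'/D. It tends to 0 because f outgrows every power of x.\<close>
  define q where "q x = (2 * \<nu> + 1) / x + (x / 2) powr \<mu> * ?k / ?f x" for x
  have pos: "?f x > 0" "?g x > 0" if "x > 0" for x
    using assms that by (auto intro!: lommel_t_pos)
  have dD: "(?D has_real_derivative ?D x * (1 + q x + ?g x / ?f x)) (at x)" if "x > 0" for x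
  proof -
    from DERIV_mult[OF exp_powr_has_derivative[OF that] lommel_t_has_derivative[OF that]] show ?thesis
    proof (rule DERIV_cong)
      have alg: "E * (1 + (\<nu> + 1) / x) * F + (\<nu> / x * F + G + K) * E
          = E * (F + ((2 * \<nu> + 1) / x * F + K) + G)" for E F G K :: real
        by (simp add: algebra_simps add_divide_distrib diff_divide_distrib)
      have "?f x * q x = (2 * \<nu> + 1) / x * ?f x + (x / 2) powr \<mu> * ?k"
        using pos(1)[OF that] by (simp add: q_def algebra_simps)
      moreover have "?f x * (?g x / ?f x) = ?g x"
        using pos(1)[OF that] by simp
      ultimately have "?f x * (1 + q x + ?g x / ?f x)
          = ?f x + ((2 * \<nu> + 1) / x * ?f x + (x / 2) powr \<mu> * ?k) + ?g x"
        by (simp only: distrib_left mult_1_right)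
      thus "exp x * x powr (\<nu> + 1) * (1 + (\<nu> + 1) / x) * ?f x + (\<nu> / x * ?f x + ?g x
          + (x / 2) powr \<mu> * rGamma ((\<mu> - \<nu> + 1) / 2) * rGamma ((\<mu> + \<nu> + 3) / 2)) * (exp x * x powr (\<nu> + 1))
          = ?D x * (1 + q x + ?g x / ?f x)"
        unfolding alg by (simp only: mult.assoc)
    qed
  qed
  have dN: "(?N has_real_derivative ?D x * q x) (at x)" if "x > 0" for x
  proof -
    have "?D x * q x = exp x * x powr (\<nu> + 1) * ((2 * \<nu> + 1) / x * ?f x + (x / 2) powr \<mu> *
        rGamma ((\<mu> - \<nu> + 1) / 2) * rGamma ((\<mu> + \<nu> + 3) / 2))"
      using pos[OF that] that by (simp add: q_def field_simps)
    thus ?thesis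
      using exp_powr_lommel_t_diff_has_derivative[OF that, of \<nu> \<mu>] by (simp only:)
  qed
  have lim: "((\<lambda>x. (2 * \<nu> + 1) / x + x powr \<mu> / ?f x * (?k / 2 powr \<mu>)) \<longlongrightarrow> 0 + 0 * (?k / 2 powr \<mu>)) at_top"
    using assms
    by (intro tendsto_intros powr_over_lommel_t_tendsto_0 real_tendsto_divide_at_top filterlim_ident) auto
  have ev: "\<forall>\<^sub>F x in at_top. (2 * \<nu> + 1) / x + x powr \<mu> / ?f x * (?k / 2 powr \<mu>) = q x"
    using eventually_gt_at_top[of 0]
    by eventually_elim (simp add: q_def powr_divide)
  have q: "(q \<longlongrightarrow> 0) at_top"
    using Lim_transform_eventually[OF lim ev] by simp
  \<comment> \<open>Positivity of g/f keeps the denominator away from 0.\<close>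
  have q': "\<forall>\<^sub>F x in at_top. 1 + q x + ?g x / ?f x \<ge> 1 / 2"
    using eventually_gt_at_top[of 0] order_tendstoD(1)[OF q, of "-1/2", simplified]
  proof eventually_elim
    case (elim x)
    have "?g x / ?f x > 0" using pos elim by auto
    with elim show ?case by linarith
  qed
  have "((\<lambda>x. ?N x / ?D x) \<longlongrightarrow> 0) at_top"
  proof (rule lhospital_at_top_at_top)
    \<comment> \<open>Since exp x is at least 1 here, \<open>?D\<close> dominates a power times
      \<open>?f\<close>, which already diverges.\<close>
    show "filterlim ?D at_top at_top"
    proof (rule filterlim_at_top_mono[OF lommel_t_over_powr_at_top[of \<mu> \<nu> "- (\<nu> + 1)"]])
      show "\<forall>\<^sub>F x in at_top. ?f x / x powr (- (\<nu> + 1)) \<le> ?D x"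
        using eventually_gt_at_top[of 0]
      proof eventually_elim
        case (elim x)
        have "1 * (x powr (\<nu> + 1) * ?f x) \<le> exp x * (x powr (\<nu> + 1) * ?f x)"
          using elim pos[OF elim] by (intro mult_right_mono) auto
        thus ?case unfolding powr_minus by (simp add: divide_inverse mult_ac)
      qed
    qed (use assms in auto)
    show "\<forall>\<^sub>F x in at_top. ?D x * (1 + q x + ?g x / ?f x) \<noteq> 0"
      using q' eventually_gt_at_top[of 0] 
    proof eventually_elim
      case (elim x)
      have "1 + q x + ?g x / ?f x \<noteq> 0"
        using elim(1) by linarith
      moreover have "?D x \<noteq> 0"
        using elim pos[of x] by auto
      ultimately
      show ?case by (rule no_zero_divisors[rotated])
    qed
    show "\<forall>\<^sub>F x in at_top. (?N has_real_derivative ?D x * q x) (at x)"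
      using eventually_gt_at_top[of 0] by eventually_elim (rule dN)
    show "\<forall>\<^sub>F x in at_top. (?D has_real_derivative ?D x * (1 + q x + ?g x / ?f x)) (at x)"
      using eventually_gt_at_top[of 0] by eventually_elim (rule dD)
    show "((\<lambda>x. ?D x * q x / (?D x * (1 + q x + ?g x / ?f x))) \<longlongrightarrow> 0) at_top"
    proof (rule Lim_null_comparison)
      show "\<forall>\<^sub>F x in at_top. norm (?D x * q x / (?D x * (1 + q x + ?g x / ?f x))) \<le> 2 * \<bar>q x\<bar>"
        using q' eventually_gt_at_top[of 0]
      proof eventually_elim
        case (elim x)
        let ?d = "1 + q x + ?g x / ?f x"
        have "?D x \<noteq> 0" using pos[of x] elim(2) by simp
        hence "?D x * q x / (?D x * ?d) = q x / ?d"
          by (rule nonzero_mult_divide_mult_cancel_left)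
        moreover have d: "?d > 0"
          using elim(1) by linarith
        ultimately have "norm (?D x * q x / (?D x * ?d)) = \<bar>q x\<bar> / ?d"
          by (simp only: real_norm_def abs_divide abs_of_pos)
        also have "\<dots> \<le> \<bar>q x\<bar> / (1/2)"
          by (rule divide_left_mono[OF elim(1)]) (use d in simp_all)
        finally show ?case by simp
      qed
      show "((\<lambda>x. 2 * \<bar>q x\<bar>) \<longlongrightarrow> 0) at_top"
        using tendsto_mult_right_zero[OF tendsto_rabs_zero[OF q]] .
    qed
  qed
  hence lim: "((\<lambda>x. 1 - ?N x / ?D x) \<longlongrightarrow> 1 - 0) at_top"
    by (intro tendsto_intros)
  have ev: "\<forall>\<^sub>F x in at_top. 1 - ?N x / ?D x = ?g x / ?f x"
    using eventually_gt_at_top[of 0]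
  proof eventually_elim
    case (elim x)
    hence "exp x * x powr (\<nu> + 1) \<noteq> 0" "?f x \<noteq> 0"
      using pos[of x] by auto
    thus ?case
      by (subst nonzero_mult_divide_mult_cancel_left) (simp_all add: diff_divide_distrib)
  qed
  show ?thesis
    using Lim_transform_eventually[OF lim ev] by simp
qed

text \<open>The derivative is factored as the function times its logarithmic derivative, the form
  suited to \<open>exp_mult_at_top_if_log_deriv\<close>.\<close>

lemma lommel_t_over_powr_has_derivative:
  assumes "\<nu> < \<mu> + 1" "\<mu> + \<nu> + 3 > 0" "x > 0"
  shows "((\<lambda>x. lommel_t \<mu> \<nu> x / x powr r) has_real_derivative
    lommel_t \<mu> \<nu> x / x powr r * ((\<nu> - r) / x + (lommel_t (\<mu> + 1) (\<nu> + 1) x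
      + (x / 2) powr \<mu> * rGamma ((\<mu> - \<nu> + 1) / 2) * rGamma ((\<mu> + \<nu> + 3) / 2)) / lommel_t \<mu> \<nu> x)) (at x)"
proof -
  have "lommel_t \<mu> \<nu> x > 0"
    using assms by (intro lommel_t_pos) auto
  moreover have "x powr (r - 1) = x powr r / x"
    using assms by (simp add: powr_diff)
  ultimately show ?thesis
    using assms
    by (auto intro!: derivative_eq_intros lommel_t_has_derivative) (simp add: field_simps)
qed

text \<open>The 1 is the limiting ratio of neighbours; (\<nu> - r)/x and the power divided by the
  Lommel function tend to 0.\<close>

lemma lommel_t_over_powr_log_deriv:
  assumes "\<nu> < \<mu> + 1" "\<mu> + \<nu> + 3 > 0"
  shows "((\<lambda>x. (\<nu> - r) / x + (lommel_t (\<mu> + 1) (\<nu> + 1) x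
      + (x / 2) powr \<mu> * rGamma ((\<mu> - \<nu> + 1) / 2) * rGamma ((\<mu> + \<nu> + 3) / 2)) / lommel_t \<mu> \<nu> x)
      \<longlongrightarrow> 1) at_top"
proof -
  let ?k = "rGamma ((\<mu> - \<nu> + 1) / 2) * rGamma ((\<mu> + \<nu> + 3) / 2)"
  have lim: "((\<lambda>x. (\<nu> - r) / x + (lommel_t (\<mu> + 1) (\<nu> + 1) x / lommel_t \<mu> \<nu> x
            + x powr \<mu> / lommel_t \<mu> \<nu> x * (?k / 2 powr \<mu>)))
          \<longlongrightarrow> 0 + (1 + 0 * (?k / 2 powr \<mu>))) at_top"
    using assms
    by (intro tendsto_intros lommel_t_Suc_ratio powr_over_lommel_t_tendsto_0
        real_tendsto_divide_at_top filterlim_ident) auto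
  have ev: "\<forall>\<^sub>F x in at_top. (\<nu> - r) / x + (lommel_t (\<mu> + 1) (\<nu> + 1) x / lommel_t \<mu> \<nu> x
            + x powr \<mu> / lommel_t \<mu> \<nu> x * (?k / 2 powr \<mu>))
     = (\<nu> - r) / x + (lommel_t (\<mu> + 1) (\<nu> + 1) x
      + (x / 2) powr \<mu> * rGamma ((\<mu> - \<nu> + 1) / 2) * rGamma ((\<mu> + \<nu> + 3) / 2)) / lommel_t \<mu> \<nu> x"
    using eventually_gt_at_top[of 0]
    by eventually_elim (simp add: powr_divide add_divide_distrib mult_ac)
  show ?thesis
    using Lim_transform_eventually[OF lim ev] by simp
qed

lemma exp_lommel_t_over_powr_at_top:
  assumes "\<nu> < \<mu> + 1" "\<mu> + \<nu> + 3 > 0" "\<beta> < 1"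
  shows "filterlim (\<lambda>x. exp (- \<beta> * x) * (lommel_t \<mu> \<nu> x / x powr r)) at_top at_top"
proof (rule exp_mult_at_top_if_log_deriv[OF lommel_t_over_powr_has_derivative])
  show pos: "0 < lommel_t \<mu> \<nu> x / x powr r" if "x > 0" for x
    using assms that by (auto intro!: divide_pos_pos lommel_t_pos)
  show "((\<lambda>x. lommel_t \<mu> \<nu> x / x powr r * ((\<nu> - r) / x + (lommel_t (\<mu> + 1) (\<nu> + 1) x
      + (x / 2) powr \<mu> * rGamma ((\<mu> - \<nu> + 1) / 2) * rGamma ((\<mu> + \<nu> + 3) / 2)) / lommel_t \<mu> \<nu> x)
      / (lommel_t \<mu> \<nu> x / x powr r)) \<longlongrightarrow> 1) at_top"
  proof (rule Lim_transform_eventually[OF lommel_t_over_powr_log_deriv[OF assms(1,2), of r]])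
    show "\<forall>\<^sub>F x in at_top. (\<nu> - r) / x + (lommel_t (\<mu> + 1) (\<nu> + 1) x
      + (x / 2) powr \<mu> * rGamma ((\<mu> - \<nu> + 1) / 2) * rGamma ((\<mu> + \<nu> + 3) / 2)) / lommel_t \<mu> \<nu> x
      = lommel_t \<mu> \<nu> x / x powr r * ((\<nu> - r) / x + (lommel_t (\<mu> + 1) (\<nu> + 1) x
      + (x / 2) powr \<mu> * rGamma ((\<mu> - \<nu> + 1) / 2) * rGamma ((\<mu> + \<nu> + 3) / 2)) / lommel_t \<mu> \<nu> x)
      / (lommel_t \<mu> \<nu> x / x powr r)"
      using eventually_gt_at_top[of 0]
    proof eventually_elim
      case (elim x)
      thus ?case using pos[OF elim] by (subst nonzero_mult_div_cancel_left) auto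
    qed
  qed
qed (use assms in auto)

text \<open>Two normalisations of one constant: the left side comes from the inhomogeneous term, the
  right side from differentiating the power subtracted in the bounds. The link is Gamma(p/2 + 1) =
  (p/2) Gamma(p/2).\<close>

lemma Gamma_consts_eq:
  fixes \<mu> \<nu> :: real
  assumes "\<nu> < \<mu> + 1" "\<mu> + \<nu> + 3 > 0"
  shows "rGamma ((\<mu> - \<nu> + 1) / 2) * rGamma ((\<mu> + \<nu> + 3) / 2) / 2 powr \<mu> =
    (\<mu> - \<nu> + 1) / (2 powr (\<mu> + 1) * Gamma ((\<mu> - \<nu> + 3) / 2) * Gamma ((\<mu> + \<nu> + 3) / 2))"
proof -
  define p where "p = \<mu> - \<nu> + 1"
  have p: "p > 0" using assms by (simp add: p_def)
  have e: "(\<mu> - \<nu> + 3) / 2 = p / 2 + 1" by (simp add: p_def field_simps)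
  have G: "Gamma (p / 2 + 1) = p / 2 * Gamma (p / 2)"
    using p by (intro Gamma_plus1) (auto dest: nonpos_Ints_nonpos)
  have "Gamma (p / 2) > 0" "Gamma ((\<mu> + \<nu> + 3) / 2) > 0"
    using p assms by (auto intro!: Gamma_real_pos)
  thus ?thesis
    using p unfolding p_def[symmetric] e G by (simp add: rGamma_inverse_Gamma powr_add divide_simps)
qed

text \<open>Dividing by exactly \<open>x powr \<nu>\<close> removes the term \<nu>/x. The remaining
  power is the derivative of the one subtracted in the first bound, where it therefore
  cancels.\<close>

lemma lommel_t_over_powr_has_derivative':
  assumes "\<nu> < \<mu> + 1" "\<mu> + \<nu> + 3 > 0" "x > 0"
  shows "((\<lambda>x. lommel_t \<mu> \<nu> x / x powr \<nu>) has_real_derivative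
    lommel_t (\<mu> + 1) (\<nu> + 1) x / x powr \<nu> + (\<mu> - \<nu> + 1) * x powr (\<mu> - \<nu>)
      / (2 powr (\<mu> + 1) * Gamma ((\<mu> - \<nu> + 3) / 2) * Gamma ((\<mu> + \<nu> + 3) / 2))) (at x)"
proof -
  let ?k = "rGamma ((\<mu> - \<nu> + 1) / 2) * rGamma ((\<mu> + \<nu> + 3) / 2)"
  have t: "lommel_t \<mu> \<nu> x > 0"
    using assms by (intro lommel_t_pos) auto
  have "lommel_t \<mu> \<nu> x / x powr \<nu> * ((\<nu> - \<nu>) / x + (lommel_t (\<mu> + 1) (\<nu> + 1) x
      + (x / 2) powr \<mu> * rGamma ((\<mu> - \<nu> + 1) / 2) * rGamma ((\<mu> + \<nu> + 3) / 2)) / lommel_t \<mu> \<nu> x)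
    = lommel_t (\<mu> + 1) (\<nu> + 1) x / x powr \<nu> + x powr (\<mu> - \<nu>) * (?k / 2 powr \<mu>)"
    using t \<open>x > 0\<close> by (simp add: powr_diff powr_divide add_divide_distrib distrib_left mult_ac)
  thus ?thesis
    using lommel_t_over_powr_has_derivative[OF assms, of \<nu>]
    unfolding Gamma_consts_eq[OF assms(1,2)] by (simp add: mult_ac)
qed

lemma lommel_t_Suc_over_powr_has_derivative:
  assumes "x > 0"
  shows "((\<lambda>x. lommel_t (\<mu> + 1) (\<nu> + 1) x / x powr r) has_real_derivative
           (lommel_t \<mu> \<nu> x - (\<nu> + r + 1) / x * lommel_t (\<mu> + 1) (\<nu> + 1) x) / x powr r) (at x)"
proof -
  have "x powr (r - 1) = x powr r / x"
    using assms by (simp add: powr_diff)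
  thus ?thesis
    using assms
    by (auto intro!: derivative_eq_intros lommel_t_Suc_has_derivative) (simp add: field_simps)
qed

text \<open>The factor \<open>h\<close> will be the constant 1 or an exponential weight. The
  integrand is u^(\<mu> + 1 - r) times a continuous function, and r < \<mu> + 2 says that this power
  is integrable at 0.\<close>

lemma
  fixes h :: "real \<Rightarrow> real"
  assumes h: "continuous_on UNIV h" and r: "r < \<mu> + 2"
  shows has_real_derivative_integral_lommel_t:
      "x > 0 \<Longrightarrow> ((\<lambda>x. integral {0..x} (\<lambda>u. h u * (lommel_t \<mu> \<nu> u / u powr r)))
         has_real_derivative h x * (lommel_t \<mu> \<nu> x / x powr r)) (at x)"
    and tendsto_integral_lommel_t:
      "((\<lambda>x. integral {0..x} (\<lambda>u. h u * (lommel_t \<mu> \<nu> u / u powr r))) \<longlongrightarrow> 0) (at_right 0)"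
proof -
  let ?G = "\<lambda>u. h u * lommel_series ((\<mu> - \<nu> + 1) / 2) ((\<mu> + \<nu> + 3) / 2) ((u / 2)\<^sup>2) / 2 powr (\<mu> + 1)"
  have 1: "\<mu> + 1 - r > -1" using r by simp
  have 2: "continuous_on UNIV ?G"
    by (intro continuous_intros h) auto
  \<comment> \<open>At u = 0 both sides are 0, by the conventions for \<open>powr\<close> and for
    division by zero.\<close>
  have 3: "h u * (lommel_t \<mu> \<nu> u / u powr r) = u powr (\<mu> + 1 - r) * ?G u" if "u \<ge> 0" for u
    using that by (cases "u = 0") (simp_all add: lommel_t_conv_series powr_diff powr_divide mult_ac)
  show "x > 0 \<Longrightarrow> ((\<lambda>x. integral {0..x} (\<lambda>u. h u * (lommel_t \<mu> \<nu> u / u powr r)))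
         has_real_derivative h x * (lommel_t \<mu> \<nu> x / x powr r)) (at x)"
    by (rule has_real_derivative_integral_powr_mult[OF 1 2]) (use 3 in auto)
  show "((\<lambda>x. integral {0..x} (\<lambda>u. h u * (lommel_t \<mu> \<nu> u / u powr r))) \<longlongrightarrow> 0) (at_right 0)"
    by (rule tendsto_integral_powr_mult[OF 1 2]) (use 3 in auto)
qed

text \<open>The integrand is a power of exponent a - 1 > -1 times a continuous function, so the
  general facts on such integrals apply. The scaling by \<beta> enters through the chain rule and
  because \<beta> x also tends to 0 from the right.\<close>

lemma
  assumes "a > 0" "\<beta> > 0"
  shows has_real_derivative_lower_Gamma:
      "x > 0 \<Longrightarrow> ((\<lambda>x. lower_Gamma a (\<beta> * x)) has_real_derivative
          \<beta> * ((\<beta> * x) powr (a - 1) * exp (- (\<beta> * x)))) (at x)"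
    and tendsto_lower_Gamma: "((\<lambda>x. lower_Gamma a (\<beta> * x)) \<longlongrightarrow> 0) (at_right 0)"
proof -
  have 1: "a - 1 > -1" using assms by simp
  have 2: "continuous_on UNIV (\<lambda>u::real. exp (- u))"
    by (intro continuous_intros)
  have "filterlim (\<lambda>x. \<beta> * x) (nhds (\<beta> * 0)) (at_right 0)"
    by (intro tendsto_intros)
  hence "filterlim (\<lambda>x. \<beta> * x) (at_right 0) (at_right 0)"
    using assms by (auto simp: filterlim_at intro!: eventually_at_rightI[of 0 1])
  thus "((\<lambda>x. lower_Gamma a (\<beta> * x)) \<longlongrightarrow> 0) (at_right 0)"
    unfolding lower_Gamma_def
    by (rule filterlim_compose[OF tendsto_integral_powr_mult[OF 1 2 refl]])
  assume "x > 0"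
  hence "\<beta> * x > 0" using assms by simp
  from has_real_derivative_integral_powr_mult[OF 1 2 refl this]
  have "(lower_Gamma a has_real_derivative (\<beta> * x) powr (a - 1) * exp (- (\<beta> * x))) (at (\<beta> * x))"
    by (simp add: lower_Gamma_def[abs_def])
  from DERIV_chain2[where g = "\<lambda>x. \<beta> * x", OF this DERIV_cmult_Id]
  show "((\<lambda>x. lower_Gamma a (\<beta> * x)) has_real_derivative
          \<beta> * ((\<beta> * x) powr (a - 1) * exp (- (\<beta> * x)))) (at x)"
    by (simp add: mult_ac)
qed

section \<open>Integrals without shift or exponential weight\<close>

text \<open>I' and R' are neighbouring Lommel functions over the same power, so the inequality
  reduces to \<open>lommel_t_Suc_less\<close> and tightness to
  \<open>lommel_t_Suc_ratio\<close>.\<close>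

lemma
  fixes \<mu> \<nu> :: real
  assumes \<nu>: "\<nu> \<ge> - 1 / 2" "\<nu> < \<mu> + 1" and \<mu>: "\<mu> > - 3 / 2"
  defines "I \<equiv> \<lambda>x. integral {0..x} (\<lambda>u. lommel_t \<mu> \<nu> u / u powr \<nu>)"
  defines "R \<equiv> \<lambda>x. lommel_t \<mu> \<nu> x / x powr \<nu> - x powr (\<mu> - \<nu> + 1)
      / (2 powr (\<mu> + 1) * Gamma ((\<mu> - \<nu> + 3) / 2) * Gamma ((\<mu> + \<nu> + 3) / 2))"
  shows integral_lommel_t_gt: "x > 0 \<Longrightarrow> I x > R x"
    and integral_lommel_t_tight: "tight I R at_top"
proof -
  let ?K = "2 powr (\<mu> + 1) * Gamma ((\<mu> - \<nu> + 3) / 2) * Gamma ((\<mu> + \<nu> + 3) / 2)"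
  have ms: "\<mu> + \<nu> + 3 > 0" "\<mu> + \<nu> + 2 > 0" using \<nu> \<mu> by auto
  have I: "(I has_real_derivative lommel_t \<mu> \<nu> x / x powr \<nu>) (at x)" if "x > 0" for x
    unfolding I_def using has_real_derivative_integral_lommel_t[of "\<lambda>_. 1" \<nu> \<mu> x \<nu>] \<nu> that by simp
  have R: "(R has_real_derivative lommel_t (\<mu> + 1) (\<nu> + 1) x / x powr \<nu>) (at x)" if "x > 0" for x
    unfolding R_def
    by (rule DERIV_cong[OF DERIV_diff[OF lommel_t_over_powr_has_derivative'[OF \<nu>(2) ms(1) that]
          DERIV_cdivide[OF has_real_derivative_powr[OF that]]]]) simp
  have "((\<lambda>x. lommel_t \<mu> \<nu> x / x powr \<nu> - x powr (\<mu> - \<nu> + 1) / ?K) \<longlongrightarrow> 0 - 0 / ?K) (at_right 0)"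
    using \<nu> ms lommel_t_tendsto_at_right_0[of \<nu> \<mu> \<nu>]
    by (intro tendsto_diff tendsto_divide[of _ 0] tendsto_powr_at_right_0 tendsto_const)
       (auto simp: Gamma_eq_zero_iff dest!: nonpos_Ints_nonpos)
  hence R0: "(R \<longlongrightarrow> 0) (at_right 0)" by (simp add: R_def)
  have I0: "(I \<longlongrightarrow> 0) (at_right 0)"
    unfolding I_def using tendsto_integral_lommel_t[of "\<lambda>_. 1" \<nu> \<mu> \<nu>] \<nu> by simp
  show "I x > R x" if "x > 0"
  proof -
    have "I x - R x > 0"
    proof (rule tendsto_0_at_right_imp_pos[OF _ _ _ that])
      show "((\<lambda>x. I x - R x) \<longlongrightarrow> 0) (at_right 0)"
        using tendsto_diff[OF I0 R0] by simp
      show "((\<lambda>x. I x - R x) has_real_derivative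
          lommel_t \<mu> \<nu> x / x powr \<nu> - lommel_t (\<mu> + 1) (\<nu> + 1) x / x powr \<nu>) (at x)" if "x > 0" for x
        using that by (intro DERIV_diff I R)
      show "lommel_t \<mu> \<nu> x / x powr \<nu> - lommel_t (\<mu> + 1) (\<nu> + 1) x / x powr \<nu> > 0" if "x > 0" for x
        using that \<nu> ms by (auto intro!: divide_strict_right_mono lommel_t_Suc_less)
    qed
    thus ?thesis by simp
  qed
  show "tight I R at_top"
  proof (rule tight_at_topI[OF I R])
    show "filterlim (\<lambda>x. lommel_t \<mu> \<nu> x / x powr \<nu>) at_top at_top"
      using \<nu> ms by (intro lommel_t_over_powr_at_top) auto
    have ev: "\<forall>\<^sub>F x in at_top. lommel_t (\<mu> + 1) (\<nu> + 1) x / lommel_t \<mu> \<nu> x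
        = lommel_t (\<mu> + 1) (\<nu> + 1) x / x powr \<nu> / (lommel_t \<mu> \<nu> x / x powr \<nu>)"
      using eventually_gt_at_top[of 0] by eventually_elim simp
    show "((\<lambda>x. lommel_t (\<mu> + 1) (\<nu> + 1) x / x powr \<nu> / (lommel_t \<mu> \<nu> x / x powr \<nu>)) \<longlongrightarrow> 1) at_top"
      by (rule Lim_transform_eventually[OF lommel_t_Suc_ratio[OF \<nu>(2) ms(1)] ev])
  qed
qed

section \<open>Integrals with shifted parameters\<close>

context
  fixes n \<mu> \<nu> :: real
  assumes n: "n > -1" and \<mu>: "\<mu> > - (n + 3) / 2" and \<nu>: "- (n + 1) / 2 \<le> \<nu>" "\<nu> < \<mu> + 1"
begin

abbreviation (input) "shift_int \<equiv> \<lambda>x. integral {0..x} (\<lambda>u. lommel_t (\<mu> + n) (\<nu> + n) u / u powr \<nu>)"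
abbreviation (input) "shift_lower \<equiv> \<lambda>x. lommel_t (\<mu> + n + 1) (\<nu> + n + 1) x / x powr \<nu>
                - b_const \<mu> \<nu> n * x powr (\<mu> - \<nu> + n + 2)"
abbreviation (input) "shift_upper \<equiv> \<lambda>x. 2 * (\<nu> + n + 1) / (n + 1)
                  * (lommel_t (\<mu> + n + 1) (\<nu> + n + 1) x / x powr \<nu>)
                - (2 * \<nu> + n + 1) / (n + 1)
                  * (lommel_t (\<mu> + n + 3) (\<nu> + n + 3) x / x powr \<nu>)
                + c_const \<mu> \<nu> n * x powr (\<mu> - \<nu> + n + 4)
                - d_const \<mu> \<nu> n * x powr (\<mu> - \<nu> + n + 2)"

text \<open>The context admits the endpoint \<nu> = -(n + 1)/2 for the sake of the equality case, so
  2\<nu> + n + 1 is only nonnegative here; the strict bounds assume its positivity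
  separately.\<close>

lemma param_ineqs:
  "2 * \<nu> + n + 1 \<ge> 0" "\<mu> + \<nu> + 2 * n + 3 > 0" "\<mu> - \<nu> + 1 > 0" "\<nu> + n + 1 > 0" "\<mu> - \<nu> + n + 2 > 0"
proof -
  show "2 * \<nu> + n + 1 \<ge> 0" "\<mu> + \<nu> + 2 * n + 3 > 0" "\<mu> - \<nu> + 1 > 0" "\<nu> + n + 1 > 0"
    using n \<mu> \<nu> by (simp_all add: field_simps)
  thus "\<mu> - \<nu> + n + 2 > 0" using n by simp
qed

lemma lommel_t_shift_pos:
  assumes "k \<ge> 0" "x > 0"
  shows "lommel_t (\<mu> + n + k) (\<nu> + n + k) x > 0"
  using assms param_ineqs by (intro lommel_t_pos) auto

lemma shift_int_has_derivative:
  assumes "x > 0"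
  shows "(shift_int has_real_derivative lommel_t (\<mu> + n) (\<nu> + n) x / x powr \<nu>) (at x)"
  using has_real_derivative_integral_lommel_t[of "\<lambda>_. 1" \<nu> "\<mu> + n" x "\<nu> + n"] assms n \<nu> by simp

lemma shift_int_tendsto_0: "(shift_int \<longlongrightarrow> 0) (at_right 0)"
  using tendsto_integral_lommel_t[of "\<lambda>_. 1" \<nu> "\<mu> + n" "\<nu> + n"] n \<nu> by simp

lemma lommel_t_shift_tendsto_0:
  assumes "k \<ge> 1"
  shows "((\<lambda>x. lommel_t (\<mu> + n + k) (\<nu> + n + k) x / x powr \<nu>) \<longlongrightarrow> 0) (at_right 0)"
  using lommel_t_tendsto_at_right_0[of \<nu> "\<mu> + n + k" "\<nu> + n + k"] assms n \<nu> by simp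

lemma shift_lower_tendsto_0: "(shift_lower \<longlongrightarrow> 0) (at_right 0)"
proof -
  have "(shift_lower \<longlongrightarrow> 0 - b_const \<mu> \<nu> n * 0) (at_right 0)"
    using param_ineqs by (intro tendsto_intros tendsto_powr_at_right_0 lommel_t_shift_tendsto_0) auto
  thus ?thesis by simp
qed

lemma shift_upper_tendsto_0: "(shift_upper \<longlongrightarrow> 0) (at_right 0)"
proof -
  have "(shift_upper \<longlongrightarrow> 2 * (\<nu> + n + 1) / (n + 1) * 0 - (2 * \<nu> + n + 1) / (n + 1) * 0
      + c_const \<mu> \<nu> n * 0 - d_const \<mu> \<nu> n * 0) (at_right 0)"
    using param_ineqs by (intro tendsto_intros tendsto_powr_at_right_0 lommel_t_shift_tendsto_0) auto
  thus ?thesis by simp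
qed

lemma shift_lower_has_derivative:
  assumes "x > 0"
  shows "(shift_lower has_real_derivative
    lommel_t (\<mu> + n) (\<nu> + n) x / x powr \<nu>
    - (2 * \<nu> + n + 1) / x * (lommel_t (\<mu> + n + 1) (\<nu> + n + 1) x / x powr \<nu>)
    - b_const \<mu> \<nu> n * (\<mu> - \<nu> + n + 2) * x powr (\<mu> - \<nu> + n + 1)) (at x)"
proof -
  have arith: "\<nu> + n + \<nu> + 1 = 2 * \<nu> + n + 1" "\<mu> - \<nu> + n + 2 - 1 = \<mu> - \<nu> + n + 1"
    by simp_all
  show ?thesis
    by (rule DERIV_cong[OF DERIV_diff[OF lommel_t_Suc_over_powr_has_derivative[OF assms]
          DERIV_cmult[OF has_real_derivative_powr[OF assms]]]])
       (simp only: arith diff_divide_distrib times_divide_eq_right mult.assoc)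
qed

text \<open>The two coefficients of the bound are matched to the recurrence: after substitution the
  functions at shifts 1 and 2 cancel, and the d-term removes the inhomogeneous term. What remains is
  the integrand, a shift-3 term and the derivative of the c-term.\<close>

lemma shift_upper_has_derivative:
  assumes x: "x > 0"
  shows "(shift_upper has_real_derivative
    lommel_t (\<mu> + n) (\<nu> + n) x / x powr \<nu>
    + (2 * \<nu> + n + 1) * (2 * \<nu> + n + 3) / (n + 1) / x * (lommel_t (\<mu> + n + 3) (\<nu> + n + 3) x / x powr \<nu>)
    + c_const \<mu> \<nu> n * (\<mu> - \<nu> + n + 4) * x powr (\<mu> - \<nu> + n + 3)) (at x)"
proof -
  define T where "T k = lommel_t (\<mu> + n + k) (\<nu> + n + k) x" for k
  define q where "q = 2 * \<nu> + n + 1"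
  define w where "w = x powr \<nu>"
  \<comment> \<open>The inhomogeneous term of the recurrence between shifts 0, 1 and 2.\<close>
  define C where "C = (x / 2) powr (\<mu> + n + 1) * rGamma ((\<mu> - \<nu> + 1) / 2) * rGamma ((\<mu> + \<nu> + 2 * n + 5) / 2)"
  have [simp]: "w \<noteq> 0" "n + 1 \<noteq> 0" "x \<noteq> 0"
    using x n by (auto simp: w_def)
  have arith: "\<nu> + n + \<nu> + 1 = q" "\<nu> + n + 2 + \<nu> + 1 = q + 2" "\<mu> + n + 2 + 1 = \<mu> + n + 3"
    "\<nu> + n + 2 + 1 = \<nu> + n + 3"
    by (simp_all add: q_def)
  have A: "((\<lambda>x. lommel_t (\<mu> + n + 1) (\<nu> + n + 1) x / x powr \<nu>) has_real_derivative
      (T 0 - q / x * T 1) / w) (at x)"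
    using lommel_t_Suc_over_powr_has_derivative[OF x, of "\<mu> + n" "\<nu> + n" \<nu>]
    by (simp add: T_def w_def q_def)
  have B: "((\<lambda>x. lommel_t (\<mu> + n + 3) (\<nu> + n + 3) x / x powr \<nu>) has_real_derivative
      (T 2 - (q + 2) / x * T 3) / w) (at x)"
    using lommel_t_Suc_over_powr_has_derivative[OF x, of "\<mu> + n + 2" "\<nu> + n + 2" \<nu>]
    by (simp only: T_def w_def arith)
  have P: "((\<lambda>x. x powr r) has_real_derivative r * x powr (r - 1)) (at x)" for r
    using x by (rule has_real_derivative_powr)
  have rec: "T 0 = (q + n + 1) / x * T 1 + T 2 + C"
  proof -
    have "\<mu> + n - (\<nu> + n) + 1 = \<mu> - \<nu> + 1" "\<mu> + n + (\<nu> + n) + 5 = \<mu> + \<nu> + 2 * n + 5"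
      "2 * (\<nu> + n + 1) = q + n + 1"
      by (simp_all add: q_def)
    thus ?thesis
      using lommel_t_recurrence[OF x, of "\<mu> + n" "\<nu> + n"]
      by (simp only: T_def C_def) simp
  qed
  \<comment> \<open>This identity explains the value of \<open>d_const\<close>: the derivative of
    the d-term is the multiple of C/w that the recurrence leaves over.\<close>
  have d: "d_const \<mu> \<nu> n * (\<mu> - \<nu> + n + 2) * x powr (\<mu> - \<nu> + n + 1) = q / (n + 1) * (C / w)"
  proof -
    have d1: "d_const \<mu> \<nu> n * (\<mu> - \<nu> + n + 2) = q / (n + 1) *
        (rGamma ((\<mu> - \<nu> + 1) / 2) * rGamma ((\<mu> + \<nu> + 2 * n + 5) / 2) / 2 powr (\<mu> + n + 1))"
    proof -
      have "q / (P * k * m * g * h) * m = q / k * (inverse g * inverse h / P)" if "m \<noteq> 0" for P k m g h :: real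
        using that by (simp add: divide_inverse)
      moreover have "\<mu> - \<nu> + n + 2 \<noteq> 0" using param_ineqs by simp
      ultimately show ?thesis
        unfolding d_const_def q_def rGamma_inverse_Gamma by blast
    qed
    have "x powr (\<mu> + n + 1) = x powr (\<mu> - \<nu> + n + 1) * w"
      unfolding w_def powr_add[symmetric] by (simp add: algebra_simps)
    hence "C / w = x powr (\<mu> - \<nu> + n + 1) *
        (rGamma ((\<mu> - \<nu> + 1) / 2) * rGamma ((\<mu> + \<nu> + 2 * n + 5) / 2) / 2 powr (\<mu> + n + 1))"
      using x by (simp add: C_def powr_divide)
    thus ?thesis
      by (simp only: d1 mult_ac)
  qed
  have der: "(shift_upper has_real_derivative
      2 * (\<nu> + n + 1) / (n + 1) * ((T 0 - q / x * T 1) / w)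
      - (2 * \<nu> + n + 1) / (n + 1) * ((T 2 - (q + 2) / x * T 3) / w)
      + c_const \<mu> \<nu> n * ((\<mu> - \<nu> + n + 4) * x powr (\<mu> - \<nu> + n + 4 - 1))
      - d_const \<mu> \<nu> n * ((\<mu> - \<nu> + n + 2) * x powr (\<mu> - \<nu> + n + 2 - 1))) (at x)"
    by (intro DERIV_add DERIV_diff DERIV_cmult A B P)
  have eq: "2 * (\<nu> + n + 1) / (n + 1) * ((T 0 - q / x * T 1) / w)
      - (2 * \<nu> + n + 1) / (n + 1) * ((T 2 - (q + 2) / x * T 3) / w)
      + c_const \<mu> \<nu> n * ((\<mu> - \<nu> + n + 4) * x powr (\<mu> - \<nu> + n + 4 - 1))
      - d_const \<mu> \<nu> n * ((\<mu> - \<nu> + n + 2) * x powr (\<mu> - \<nu> + n + 2 - 1))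
    = T 0 / w + q * (q + 2) / (n + 1) / x * (T 3 / w)
      + c_const \<mu> \<nu> n * (\<mu> - \<nu> + n + 4) * x powr (\<mu> - \<nu> + n + 3)"
  proof -
    have "2 * (\<nu> + n + 1) = q + n + 1" "2 * \<nu> + n + 1 = q"
      "\<mu> - \<nu> + n + 4 - 1 = \<mu> - \<nu> + n + 3" "\<mu> - \<nu> + n + 2 - 1 = \<mu> - \<nu> + n + 1"
      by (simp_all add: q_def)
    moreover have "(q + n + 1) / (n + 1) * ((T 0 - q / x * T 1) / w)
        - q / (n + 1) * ((T 2 - (q + 2) / x * T 3) / w) - q / (n + 1) * (C / w)
       = T 0 / w + q * (q + 2) / (n + 1) / x * (T 3 / w)"
    proof -
      \<comment> \<open>These variables absorb the divisions by x and w, so the claim becomes a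
        polynomial consequence of the recurrence and r(n + 1) = q. Shift 1 cancels because (1 + r) q
        = r (q + n + 1).\<close>
      define r t0 t1 t2 t3 c where "r = q / (n + 1)" and "t0 = T 0 / w" and "t1 = T 1 / x / w"
        and "t2 = T 2 / w" and "t3 = T 3 / x / w" and "c = C / w"
      note rt = this
      have "t0 = (q + n + 1) * t1 + t2 + c"
        by (simp add: rt rec add_divide_distrib[of _ C w] add_divide_distrib[of _ "T 2" w])
      moreover have "r * (n + 1) = q" by (simp add: rt)
      ultimately have "(1 + r) * (t0 - q * t1) - r * (t2 - (q + 2) * t3) - r * c = t0 + r * (q + 2) * t3"
        by algebra
      moreover have "1 + r = (q + n + 1) / (n + 1)" by (simp add: rt divide_simps)
      moreover have "t0 - q * t1 = (T 0 - q / x * T 1) / w" "t2 - (q + 2) * t3 = (T 2 - (q + 2) / x * T 3) / w"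
        "r * (q + 2) * t3 = q * (q + 2) / (n + 1) / x * (T 3 / w)"
        by (simp_all add: rt diff_divide_distrib)
      ultimately show ?thesis by (simp only: rt)
    qed
    ultimately show ?thesis
      using d by (simp only: mult.assoc)
  qed
  have "2 * \<nu> + n + 1 + 2 = 2 * \<nu> + n + 3" by simp
  with DERIV_cong[OF der eq] show ?thesis
    by (simp only: T_def w_def q_def add_0_right)
qed

section \<open>Tightness of the bounds with shifted parameters\<close>

lemma shift_int_integrand_pos: "x > 0 \<Longrightarrow> lommel_t (\<mu> + n) (\<nu> + n) x / x powr \<nu> > 0"
  using lommel_t_shift_pos[of 0 x] by simp

lemma shift_int_integrand_at_top: "filterlim (\<lambda>x. lommel_t (\<mu> + n) (\<nu> + n) x / x powr \<nu>) at_top at_top"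
  using param_ineqs by (intro lommel_t_over_powr_at_top) auto

text \<open>The next shift is a separate variable so that the numerals 1, 2 and 3 unify
  directly.\<close>

lemma Suc_shift_ratio:
  assumes "k \<ge> 0" "k' = k + 1"
  shows "((\<lambda>x. lommel_t (\<mu> + n + k') (\<nu> + n + k') x / lommel_t (\<mu> + n + k) (\<nu> + n + k) x) \<longlongrightarrow> 1) at_top"
  using lommel_t_Suc_ratio[of "\<nu> + n + k" "\<mu> + n + k"] assms param_ineqs by (simp add: add_ac)

text \<open>Divided by the integrand, the derivative of the bound is 1 minus a multiple of 1/x times
  a neighbour ratio, minus a power over a Lommel function; both corrections tend to 0.\<close>

lemma shift_lower_tight: "tight shift_int shift_lower at_top"
proof (rule tight_at_topI[OF shift_int_has_derivative shift_lower_has_derivative shift_int_integrand_at_top])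
  let ?T = "\<lambda>k x. lommel_t (\<mu> + n + k) (\<nu> + n + k) x"
  let ?g = "\<lambda>x. 1 - (2 * \<nu> + n + 1) / x * (?T 1 x / ?T 0 x)
          - b_const \<mu> \<nu> n * (\<mu> - \<nu> + n + 2) * (x powr (\<mu> + n + 1) / ?T 0 x)"
  have "(?g \<longlongrightarrow>
        1 - 0 * 1 - b_const \<mu> \<nu> n * (\<mu> - \<nu> + n + 2) * 0) at_top"
    using param_ineqs
    by (intro tendsto_intros Suc_shift_ratio powr_over_lommel_t_tendsto_0
        real_tendsto_divide_at_top filterlim_ident) auto
  hence lim: "(?g \<longlongrightarrow> 1) at_top" by simp
  have ev: "\<forall>\<^sub>F x in at_top. ?g x =
     (lommel_t (\<mu> + n) (\<nu> + n) x / x powr \<nu>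
    - (2 * \<nu> + n + 1) / x * (lommel_t (\<mu> + n + 1) (\<nu> + n + 1) x / x powr \<nu>)
    - b_const \<mu> \<nu> n * (\<mu> - \<nu> + n + 2) * x powr (\<mu> - \<nu> + n + 1)) / (lommel_t (\<mu> + n) (\<nu> + n) x / x powr \<nu>)"
    using eventually_gt_at_top[of 0]
  proof eventually_elim
    case (elim x)
    have "x powr (\<mu> + n + 1) = x powr (\<mu> - \<nu> + n + 1) * x powr \<nu>"
      unfolding powr_add[symmetric] by (simp add: algebra_simps)
    moreover have "1 - q / x * (U / T) - b * (X * w / T) = (T / w - q / x * (U / w) - b * X) / (T / w)"
      if "T \<noteq> 0" "w \<noteq> 0" for q b T U X w :: real
      unfolding diff_divide_distrib using that by simp
    ultimately show ?case
      using elim lommel_t_shift_pos[of 0 x] by simp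
  qed
  show "((\<lambda>x. (lommel_t (\<mu> + n) (\<nu> + n) x / x powr \<nu>
    - (2 * \<nu> + n + 1) / x * (lommel_t (\<mu> + n + 1) (\<nu> + n + 1) x / x powr \<nu>)
    - b_const \<mu> \<nu> n * (\<mu> - \<nu> + n + 2) * x powr (\<mu> - \<nu> + n + 1)) / (lommel_t (\<mu> + n) (\<nu> + n) x / x powr \<nu>))
    \<longlongrightarrow> 1) at_top"
    by (rule Lim_transform_eventually[OF lim ev])
qed

text \<open>Generic in the filter, so that the same division by the integrand serves x \<rightarrow>
  \<infinity> and x \<down> 0. The two limits differ only in why the two quotients vanish.\<close>

lemma shift_upper_tendsto_ratio:
  assumes 1: "((\<lambda>x. lommel_t (\<mu> + n + 3) (\<nu> + n + 3) x / (x * lommel_t (\<mu> + n) (\<nu> + n) x)) \<longlongrightarrow> 0) F"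
    and 2: "((\<lambda>x. x powr (\<mu> + n + 3) / lommel_t (\<mu> + n) (\<nu> + n) x) \<longlongrightarrow> 0) F"
    and F: "\<forall>\<^sub>F x in F. x > 0"
  shows "((\<lambda>x. (lommel_t (\<mu> + n) (\<nu> + n) x / x powr \<nu>
    + (2 * \<nu> + n + 1) * (2 * \<nu> + n + 3) / (n + 1) / x * (lommel_t (\<mu> + n + 3) (\<nu> + n + 3) x / x powr \<nu>)
    + c_const \<mu> \<nu> n * (\<mu> - \<nu> + n + 4) * x powr (\<mu> - \<nu> + n + 3)) / (lommel_t (\<mu> + n) (\<nu> + n) x / x powr \<nu>))
    \<longlongrightarrow> 1) F"
proof (rule Lim_transform_eventually)
  let ?f = "\<lambda>x. 1 + (2 * \<nu> + n + 1) * (2 * \<nu> + n + 3) / (n + 1) *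
      (lommel_t (\<mu> + n + 3) (\<nu> + n + 3) x / (x * lommel_t (\<mu> + n) (\<nu> + n) x))
      + c_const \<mu> \<nu> n * (\<mu> - \<nu> + n + 4) * (x powr (\<mu> + n + 3) / lommel_t (\<mu> + n) (\<nu> + n) x)"
  have "(?f \<longlongrightarrow> 1 + (2 * \<nu> + n + 1) * (2 * \<nu> + n + 3) / (n + 1) * 0
      + c_const \<mu> \<nu> n * (\<mu> - \<nu> + n + 4) * 0) F"
    by (intro tendsto_intros 1 2)
  thus "(?f \<longlongrightarrow> 1) F" by simp
  show "\<forall>\<^sub>F x in F. ?f x = (lommel_t (\<mu> + n) (\<nu> + n) x / x powr \<nu>
    + (2 * \<nu> + n + 1) * (2 * \<nu> + n + 3) / (n + 1) / x * (lommel_t (\<mu> + n + 3) (\<nu> + n + 3) x / x powr \<nu>)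
    + c_const \<mu> \<nu> n * (\<mu> - \<nu> + n + 4) * x powr (\<mu> - \<nu> + n + 3)) / (lommel_t (\<mu> + n) (\<nu> + n) x / x powr \<nu>)"
    using F
  proof eventually_elim
    case (elim x)
    have pw: "x powr (\<mu> + n + 3) = x powr (\<mu> - \<nu> + n + 3) * x powr \<nu>"
      unfolding powr_add[symmetric] by (simp add: algebra_simps)
    have alg: "1 + q * (U / (x * T)) + c * (X * w / T) = (T / w + q / x * (U / w) + c * X) / (T / w)"
      if "T \<noteq> 0" "w \<noteq> 0" for q c T U X w :: real
      unfolding add_divide_distrib using that by simp
    show ?case
      unfolding pw by (rule alg) (use elim lommel_t_shift_pos[of 0 x] in auto)
  qed
qed

lemma shift_upper_tight: "tight shift_int shift_upper at_top"
proof (rule tight_at_topI[OF shift_int_has_derivative shift_upper_has_derivative shift_int_integrand_at_top shift_upper_tendsto_ratio])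
  let ?T = "\<lambda>k x. lommel_t (\<mu> + n + k) (\<nu> + n + k) x"
  \<comment> \<open>The quotient of shifts 3 and 0 telescopes into three neighbour ratios tending to
    1; the factor 1/x makes the limit 0.\<close>
  have "((\<lambda>x. 1 / x * (?T 3 x / ?T 2 x) * (?T 2 x / ?T 1 x) * (?T 1 x / ?T 0 x)) \<longlongrightarrow> 0 * 1 * 1 * 1) at_top"
    by (intro tendsto_mult Suc_shift_ratio real_tendsto_divide_at_top tendsto_const filterlim_ident) auto
  hence "((\<lambda>x. 1 / x * (?T 3 x / ?T 2 x) * (?T 2 x / ?T 1 x) * (?T 1 x / ?T 0 x)) \<longlongrightarrow> 0) at_top"
    by simp
  moreover have "\<forall>\<^sub>F x in at_top. 1 / x * (?T 3 x / ?T 2 x) * (?T 2 x / ?T 1 x) * (?T 1 x / ?T 0 x)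
      = lommel_t (\<mu> + n + 3) (\<nu> + n + 3) x / (x * lommel_t (\<mu> + n) (\<nu> + n) x)"
    using eventually_gt_at_top[of 0]
  proof eventually_elim
    case (elim x)
    have "?T 1 x \<noteq> 0" "?T 2 x \<noteq> 0"
      using lommel_t_shift_pos[of 1 x] lommel_t_shift_pos[of 2 x] elim by auto
    thus ?case by simp
  qed
  ultimately show "((\<lambda>x. lommel_t (\<mu> + n + 3) (\<nu> + n + 3) x / (x * lommel_t (\<mu> + n) (\<nu> + n) x)) \<longlongrightarrow> 0) at_top"
    by (rule Lim_transform_eventually)
  show "((\<lambda>x. x powr (\<mu> + n + 3) / lommel_t (\<mu> + n) (\<nu> + n) x) \<longlongrightarrow> 0) at_top"
    using param_ineqs by (intro powr_over_lommel_t_tendsto_0) auto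
qed (auto intro: eventually_gt_at_top)

text \<open>At 0 the function at shift 0 has exact order \<mu> + n + 1. The shift-3 function has
  order \<mu> + n + 4, so even its quotient by x is of higher order, and so is x^(\<mu> + n +
  3).\<close>

lemma shift_upper_tight_at_right_0: "tight shift_int shift_upper (at_right 0)"
proof (rule tight_at_right_0I[OF shift_int_has_derivative shift_upper_has_derivative shift_int_integrand_pos
      shift_int_tendsto_0 shift_upper_tendsto_0 shift_upper_tendsto_ratio])
  \<comment> \<open>The leading coefficient of the shift-0 function at 0; its positivity allows
    division of limits.\<close>
  define l where "l = rGamma ((\<mu> - \<nu> + 3) / 2) * rGamma ((\<mu> + \<nu> + 2 * n + 3) / 2) / 2 powr (\<mu> + n + 1)"
  have "l > 0"
    unfolding l_def using param_ineqs by (intro divide_pos_pos mult_pos_pos rGamma_real_pos) auto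
  have 0: "((\<lambda>x. lommel_t (\<mu> + n) (\<nu> + n) x / x powr (\<mu> + n + 1)) \<longlongrightarrow> l) (at_right 0)"
    using lommel_t_tendsto_at_right_0[of "\<mu> + n + 1" "\<mu> + n" "\<nu> + n"] by (simp add: l_def add_ac)
  have ev: "\<forall>\<^sub>F x::real in at_right 0. x > 0"
    by (intro eventually_at_rightI[of 0 1]) auto
  \<comment> \<open>This exponent exceeds the order at shift 0 by one, to account for the extra x in
    the denominator.\<close>
  have "((\<lambda>x. lommel_t (\<mu> + n + 3) (\<nu> + n + 3) x / x powr (\<mu> + n + 2)) \<longlongrightarrow> 0) (at_right 0)"
    using lommel_t_tendsto_at_right_0[of "\<mu> + n + 2" "\<mu> + n + 3" "\<nu> + n + 3"] by simp
  from tendsto_divide[OF this 0] \<open>l > 0\<close>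
  have "((\<lambda>x. (lommel_t (\<mu> + n + 3) (\<nu> + n + 3) x / x powr (\<mu> + n + 2)) /
      (lommel_t (\<mu> + n) (\<nu> + n) x / x powr (\<mu> + n + 1))) \<longlongrightarrow> 0) (at_right 0)"
    by simp
  moreover have "\<forall>\<^sub>F x in at_right 0. (lommel_t (\<mu> + n + 3) (\<nu> + n + 3) x / x powr (\<mu> + n + 2)) /
      (lommel_t (\<mu> + n) (\<nu> + n) x / x powr (\<mu> + n + 1)) =
      lommel_t (\<mu> + n + 3) (\<nu> + n + 3) x / (x * lommel_t (\<mu> + n) (\<nu> + n) x)"
    using ev
  proof eventually_elim
    case (elim x)
    have "x powr (\<mu> + n + 2) = x * x powr (\<mu> + n + 1)"
      using elim powr_add[of x 1 "\<mu> + n + 1"] by (simp add: add_ac)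
    thus ?case using elim by simp
  qed
  ultimately show "((\<lambda>x. lommel_t (\<mu> + n + 3) (\<nu> + n + 3) x / (x * lommel_t (\<mu> + n) (\<nu> + n) x)) \<longlongrightarrow> 0) (at_right 0)"
    by (rule Lim_transform_eventually)
  have "((\<lambda>x. x powr 2 / (lommel_t (\<mu> + n) (\<nu> + n) x / x powr (\<mu> + n + 1))) \<longlongrightarrow> 0 / l) (at_right 0)"
    using \<open>l > 0\<close> by (intro tendsto_divide[OF tendsto_powr_at_right_0 0]) auto
  hence "((\<lambda>x. x powr 2 / (lommel_t (\<mu> + n) (\<nu> + n) x / x powr (\<mu> + n + 1))) \<longlongrightarrow> 0) (at_right 0)"
    by simp
  moreover have "\<forall>\<^sub>F x in at_right 0. x powr 2 / (lommel_t (\<mu> + n) (\<nu> + n) x / x powr (\<mu> + n + 1)) =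
      x powr (\<mu> + n + 3) / lommel_t (\<mu> + n) (\<nu> + n) x"
  proof (intro always_eventually allI)
    fix x :: real
    have "x powr (\<mu> + n + 3) = x powr 2 * x powr (\<mu> + n + 1)"
      unfolding powr_add[symmetric] by (simp add: add_ac)
    thus "x powr 2 / (lommel_t (\<mu> + n) (\<nu> + n) x / x powr (\<mu> + n + 1)) =
      x powr (\<mu> + n + 3) / lommel_t (\<mu> + n) (\<nu> + n) x" by simp
  qed
  ultimately show "((\<lambda>x. x powr (\<mu> + n + 3) / lommel_t (\<mu> + n) (\<nu> + n) x) \<longlongrightarrow> 0) (at_right 0)"
    by (rule Lim_transform_eventually)
  show "\<forall>\<^sub>F x::real in at_right 0. x > 0" by (rule ev)
qed

section \<open>Strict bounds and the case of equality\<close>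

lemma shift_lower_less_shift_int:
  assumes "2 * \<nu> + n + 1 > 0" "x > 0"
  shows "shift_lower x < shift_int x"
proof -
  have "shift_int x - shift_lower x > 0"
  proof (rule tendsto_0_at_right_imp_pos[OF DERIV_diff[OF shift_int_has_derivative shift_lower_has_derivative] _ _ \<open>x > 0\<close>])
    show "((\<lambda>x. shift_int x - shift_lower x) \<longlongrightarrow> 0) (at_right 0)"
      using tendsto_diff[OF shift_int_tendsto_0 shift_lower_tendsto_0] by simp
    fix y :: real assume y: "y > 0"
    have "b_const \<mu> \<nu> n > 0"
      unfolding b_const_def using assms param_ineqs
      by (intro divide_pos_pos mult_pos_pos Gamma_real_pos) auto
    hence "b_const \<mu> \<nu> n * (\<mu> - \<nu> + n + 2) * y powr (\<mu> - \<nu> + n + 1) > 0"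
      using param_ineqs y by (intro mult_pos_pos) auto
    moreover have "(2 * \<nu> + n + 1) / y * (lommel_t (\<mu> + n + 1) (\<nu> + n + 1) y / y powr \<nu>) > 0"
      using assms y lommel_t_shift_pos[of 1 y] by (intro mult_pos_pos divide_pos_pos) auto
    ultimately show "0 < lommel_t (\<mu> + n) (\<nu> + n) y / y powr \<nu> - (lommel_t (\<mu> + n) (\<nu> + n) y / y powr \<nu>
      - (2 * \<nu> + n + 1) / y * (lommel_t (\<mu> + n + 1) (\<nu> + n + 1) y / y powr \<nu>)
      - b_const \<mu> \<nu> n * (\<mu> - \<nu> + n + 2) * y powr (\<mu> - \<nu> + n + 1))"
      by linarith
  qed
  thus ?thesis by simp
qed

lemma shift_int_less_shift_upper:
  assumes "2 * \<nu> + n + 1 > 0" "x > 0"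
  shows "shift_int x < shift_upper x"
proof -
  have "shift_upper x - shift_int x > 0"
  proof (rule tendsto_0_at_right_imp_pos[OF DERIV_diff[OF shift_upper_has_derivative shift_int_has_derivative] _ _ \<open>x > 0\<close>])
    show "((\<lambda>x. shift_upper x - shift_int x) \<longlongrightarrow> 0) (at_right 0)"
      using tendsto_diff[OF shift_upper_tendsto_0 shift_int_tendsto_0] by simp
    fix y :: real assume y: "y > 0"
    have "c_const \<mu> \<nu> n > 0"
      unfolding c_const_def using assms param_ineqs n
      by (intro divide_pos_pos mult_pos_pos Gamma_real_pos) auto
    hence "c_const \<mu> \<nu> n * (\<mu> - \<nu> + n + 4) * y powr (\<mu> - \<nu> + n + 3) > 0"
      using param_ineqs y by (intro mult_pos_pos) auto
    moreover have "(2 * \<nu> + n + 1) * (2 * \<nu> + n + 3) / (n + 1) / y *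
        (lommel_t (\<mu> + n + 3) (\<nu> + n + 3) y / y powr \<nu>) > 0"
      using assms y n lommel_t_shift_pos[of 3 y] by (intro mult_pos_pos divide_pos_pos) auto
    ultimately show "0 < lommel_t (\<mu> + n) (\<nu> + n) y / y powr \<nu>
      + (2 * \<nu> + n + 1) * (2 * \<nu> + n + 3) / (n + 1) / y * (lommel_t (\<mu> + n + 3) (\<nu> + n + 3) y / y powr \<nu>)
      + c_const \<mu> \<nu> n * (\<mu> - \<nu> + n + 4) * y powr (\<mu> - \<nu> + n + 3)
      - lommel_t (\<mu> + n) (\<nu> + n) y / y powr \<nu>"
      by linarith
  qed
  thus ?thesis by simp
qed

text \<open>When 2\<nu> + n + 1 = 0, the constants b, c, d and the shift-3 coefficient vanish, and
  2(\<nu> + n + 1) = n + 1. Both bounds become the shift-1 function over x^\<nu>, an antiderivative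
  of the integrand with limit 0 at 0.\<close>

lemma shift_int_eq:
  assumes q: "2 * \<nu> + n = - 1" and "x > 0"
  shows "shift_int x = shift_lower x \<and> shift_int x = shift_upper x"
proof -
  have q': "2 * \<nu> + n + 1 = 0" "2 * (\<nu> + n + 1) = n + 1"
    using q by auto
  have b: "b_const \<mu> \<nu> n = 0" "c_const \<mu> \<nu> n = 0" "d_const \<mu> \<nu> n = 0"
    by (simp_all add: b_const_def c_const_def d_const_def q')
  have "shift_int x - shift_lower x = 0"
  proof (rule tendsto_0_at_right_imp_eq_0[OF _ _ \<open>x > 0\<close>])
    show "((\<lambda>x. shift_int x - shift_lower x) \<longlongrightarrow> 0) (at_right 0)"
      using tendsto_diff[OF shift_int_tendsto_0 shift_lower_tendsto_0] by simp
    show "((\<lambda>x. shift_int x - shift_lower x) has_real_derivative 0) (at y)" if "y > 0" for y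
      using DERIV_diff[OF shift_int_has_derivative[OF that] shift_lower_has_derivative[OF that]]
      by (simp add: q' b)
  qed
  moreover have "shift_upper x = shift_lower x"
    unfolding q' b using n by simp
  ultimately show ?thesis by simp
qed

end

section \<open>Integrals with an exponential weight\<close>

context
  fixes \<beta> \<mu> \<nu> :: real
  assumes \<beta>: "0 < \<beta>" "\<beta> < 1"
    and \<mu>: "\<mu> > - 3 / 2" and \<nu>: "- 1 / 2 \<le> \<nu>" "\<nu> < \<mu> + 1"
begin

abbreviation (input) "lommel_quot \<equiv> \<lambda>x. lommel_t \<mu> \<nu> x / x powr \<nu>"
abbreviation (input) "lead_denom \<equiv> 2 powr (\<mu> + 1) * Gamma ((\<mu> - \<nu> + 3) / 2) * Gamma ((\<mu> + \<nu> + 3) / 2)"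
abbreviation (input) "quot_int \<equiv> \<lambda>x. integral {0..x} (\<lambda>u. lommel_t \<mu> \<nu> u / u powr \<nu>)"
abbreviation (input) "exp_int \<equiv> \<lambda>x. integral {0..x} (\<lambda>u. exp (- \<beta> * u) * (lommel_t \<mu> \<nu> u / u powr \<nu>))"
abbreviation (input) "exp_lower_int \<equiv> \<lambda>x. 1 / (1 - \<beta>) *
                (exp (- \<beta> * x) * integral {0..x} (\<lambda>u. lommel_t \<mu> \<nu> u / u powr \<nu>)
                 - \<beta> powr (- (\<mu> - \<nu> + 1)) * lower_Gamma (\<mu> - \<nu> + 2) (\<beta> * x)
                   / (2 powr (\<mu> + 1) * Gamma ((\<mu> - \<nu> + 3) / 2) * Gamma ((\<mu> + \<nu> + 3) / 2)))"
abbreviation (input) "exp_lower \<equiv> \<lambda>x. 1 / (1 - \<beta>) *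
                (exp (- \<beta> * x) * (lommel_t \<mu> \<nu> x / x powr \<nu>)
                 - ((\<beta> * x) powr (\<mu> - \<nu> + 1) + lower_Gamma (\<mu> - \<nu> + 2) (\<beta> * x))
                   / (2 powr (\<mu> + 1) * \<beta> powr (\<mu> - \<nu> + 1)
                      * Gamma ((\<mu> - \<nu> + 3) / 2) * Gamma ((\<mu> + \<nu> + 3) / 2)))"

lemma param_ineqs': "\<mu> + \<nu> + 3 > 0" "\<mu> - \<nu> + 1 > 0" "lead_denom > 0"
proof -
  show "\<mu> + \<nu> + 3 > 0" "\<mu> - \<nu> + 1 > 0"
    using \<mu> \<nu> by auto
  thus "lead_denom > 0"
    by (intro mult_pos_pos Gamma_real_pos) auto
qed

lemma lommel_quot_pos: "x > 0 \<Longrightarrow> lommel_quot x > 0"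
  using param_ineqs' by (intro divide_pos_pos lommel_t_pos) auto

lemma lommel_quot_neq_0: "x > 0 \<Longrightarrow> lommel_quot x \<noteq> 0"
  by (rule less_imp_neq[THEN not_sym]) (rule lommel_quot_pos)

lemma quot_int_has_derivative: "x > 0 \<Longrightarrow> (quot_int has_real_derivative lommel_quot x) (at x)"
  using has_real_derivative_integral_lommel_t[of "\<lambda>_. 1" \<nu> \<mu> x \<nu>] \<nu> by simp

lemma quot_int_tendsto_0: "(quot_int \<longlongrightarrow> 0) (at_right 0)"
  using tendsto_integral_lommel_t[of "\<lambda>_. 1" \<nu> \<mu> \<nu>] \<nu> by simp

lemma exp_int_has_derivative: "x > 0 \<Longrightarrow> (exp_int has_real_derivative exp (- \<beta> * x) * lommel_quot x) (at x)"
  using \<nu> by (intro has_real_derivative_integral_lommel_t continuous_intros) auto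

lemma exp_int_tendsto_0: "(exp_int \<longlongrightarrow> 0) (at_right 0)"
  using \<nu> by (intro tendsto_integral_lommel_t continuous_intros) auto

lemma exp_has_derivative:
  "((\<lambda>x. exp (- \<beta> * x)) has_real_derivative - \<beta> * exp (- \<beta> * x)) (at x)"
  by (auto intro!: derivative_eq_intros)

text \<open>The negative power of \<beta> undoes the scaling of the argument, so the derivative is
  \<beta> exp(-\<beta> x) times the term subtracted in the unweighted bound.\<close>

lemma lower_Gamma_has_derivative:
  assumes "x > 0"
  shows "((\<lambda>x. \<beta> powr (- (\<mu> - \<nu> + 1)) * lower_Gamma (\<mu> - \<nu> + 2) (\<beta> * x) / lead_denom) has_real_derivative
    exp (- \<beta> * x) * (\<beta> / lead_denom * x powr (\<mu> - \<nu> + 1))) (at x)"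
proof -
  have a: "\<mu> - \<nu> + 2 - 1 = \<mu> - \<nu> + 1" by simp
  have b: "(\<beta> * x) powr (\<mu> - \<nu> + 1) = \<beta> powr (\<mu> - \<nu> + 1) * x powr (\<mu> - \<nu> + 1)"
    using \<beta> assms by (simp add: powr_mult)
  have "\<beta> powr (- (\<mu> - \<nu> + 1)) * \<beta> powr (\<mu> - \<nu> + 1) = 1"
    unfolding powr_add[symmetric] using \<beta> by simp
  moreover have "\<beta> powr (- (\<mu> - \<nu> + 1)) * (\<beta> * (\<beta> powr (\<mu> - \<nu> + 1) * X * E)) / k
      = (\<beta> powr (- (\<mu> - \<nu> + 1)) * \<beta> powr (\<mu> - \<nu> + 1)) * (E * (\<beta> / k * X))" for X E k
    by (simp only: times_divide_eq_left times_divide_eq_right mult_ac)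
  ultimately have c: "\<beta> powr (- (\<mu> - \<nu> + 1)) * (\<beta> * (\<beta> powr (\<mu> - \<nu> + 1) * X * E)) / k
      = E * (\<beta> / k * X)" for X E k
    by simp
  have "\<mu> - \<nu> + 2 > 0" using \<nu> by simp
  from DERIV_cdivide[OF DERIV_cmult[OF has_real_derivative_lower_Gamma[OF this \<beta>(1) assms]]]
  show ?thesis
    by (rule DERIV_cong) (simp only: a b c minus_mult_left)
qed

lemma exp_lower_int_has_derivative:
  assumes "x > 0"
  shows "(exp_lower_int has_real_derivative
    exp (- \<beta> * x) / (1 - \<beta>) * (lommel_quot x - \<beta> * quot_int x - \<beta> / lead_denom * x powr (\<mu> - \<nu> + 1))) (at x)"
proof -
  have alg: "1 / (1 - \<beta>) * (- \<beta> * E * J + F * E - E * X) = E / (1 - \<beta>) * (F - \<beta> * J - X)"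
    for E J F X :: real
    by (simp add: algebra_simps add_divide_distrib diff_divide_distrib)
  show ?thesis
    by (rule DERIV_cong[OF DERIV_cmult[OF DERIV_diff[OF DERIV_mult[OF exp_has_derivative
          quot_int_has_derivative[OF assms]] lower_Gamma_has_derivative[OF assms]]]]) (rule alg)
qed

lemma exp_lower_int_tendsto_0: "(exp_lower_int \<longlongrightarrow> 0) (at_right 0)"
proof -
  have "((\<lambda>x. exp (- \<beta> * x)) \<longlongrightarrow> exp (- \<beta> * 0)) (at_right 0)"
    by (intro tendsto_intros)
  moreover have "((\<lambda>x. lower_Gamma (\<mu> - \<nu> + 2) (\<beta> * x)) \<longlongrightarrow> 0) (at_right 0)"
    using \<beta> \<nu> by (intro tendsto_lower_Gamma) simp_all
  moreover have "lead_denom \<noteq> 0" using param_ineqs'(3) by (rule less_imp_neq[THEN not_sym])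
  ultimately have "(exp_lower_int \<longlongrightarrow> 1 / (1 - \<beta>) * (exp (- \<beta> * 0) * 0 - \<beta> powr (- (\<mu> - \<nu> + 1)) * 0 / lead_denom)) (at_right 0)"
    by (intro tendsto_mult_left tendsto_diff tendsto_mult[OF _ quot_int_tendsto_0] tendsto_divide[OF _ tendsto_const])
  thus ?thesis by simp
qed

text \<open>The derivatives differ by \<beta> exp(-\<beta> x)/(1 - \<beta>) times the gap in
  \<open>integral_lommel_t_gt\<close>, which is positive.\<close>

lemma exp_lower_int_less_exp_int:
  assumes "x > 0"
  shows "exp_lower_int x < exp_int x"
proof -
  have "exp_int x - exp_lower_int x > 0"
  proof (rule tendsto_0_at_right_imp_pos[OF DERIV_diff[OF exp_int_has_derivative exp_lower_int_has_derivative] _ _ assms])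
    show "((\<lambda>x. exp_int x - exp_lower_int x) \<longlongrightarrow> 0) (at_right 0)"
      using tendsto_diff[OF exp_int_tendsto_0 exp_lower_int_tendsto_0] by simp
    fix y :: real assume y: "y > 0"
    have alg: "E * F - E / (1 - \<beta>) * (F - \<beta> * J - \<beta> / k * X) = \<beta> * E / (1 - \<beta>) * (J - (F - X / k))"
      for E F J X k :: real
    proof -
      have EF: "E * F = E / (1 - \<beta>) * ((1 - \<beta>) * F)" using \<beta> by simp
      have Y: "(1 - \<beta>) * F - (F - \<beta> * J - \<beta> / k * X) = \<beta> * (J - (F - X / k))"
        by (simp add: algebra_simps)
      have "E * F - E / (1 - \<beta>) * (F - \<beta> * J - \<beta> / k * X)
          = E / (1 - \<beta>) * ((1 - \<beta>) * F - (F - \<beta> * J - \<beta> / k * X))"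
        unfolding EF by (rule right_diff_distrib[symmetric])
      thus ?thesis unfolding Y by simp
    qed
    have "\<beta> * exp (- \<beta> * y) / (1 - \<beta>) * (quot_int y - (lommel_quot y - y powr (\<mu> - \<nu> + 1) / lead_denom)) > 0"
      using \<beta> integral_lommel_t_gt[OF \<nu> \<mu> y] by (intro mult_pos_pos divide_pos_pos) simp_all
    thus "exp (- \<beta> * y) * lommel_quot y - exp (- \<beta> * y) / (1 - \<beta>) *
        (lommel_quot y - \<beta> * quot_int y - \<beta> / lead_denom * y powr (\<mu> - \<nu> + 1)) > 0"
      unfolding alg .
  qed
  thus ?thesis by simp
qed

text \<open>Splits the fraction so that its incomplete gamma part coincides with the one in
  \<open>exp_lower_int\<close>, leaving a pure power to compare.\<close>

lemma exp_lower_fraction_eq: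
  assumes "x > 0"
  shows "((\<beta> * x) powr (\<mu> - \<nu> + 1) + L) / (2 powr (\<mu> + 1) * \<beta> powr (\<mu> - \<nu> + 1)
      * Gamma ((\<mu> - \<nu> + 3) / 2) * Gamma ((\<mu> + \<nu> + 3) / 2))
    = x powr (\<mu> - \<nu> + 1) / lead_denom + \<beta> powr (- (\<mu> - \<nu> + 1)) * L / lead_denom"
proof -
  have alg: "(B * X + L) / (P * B * g * h) = X / (P * g * h) + inverse B * L / (P * g * h)"
    if "B \<noteq> 0" for B X P g h :: real
  proof -
    have "P * B * g * h = B * (P * g * h)" by simp
    moreover have "B * X / (B * (P * g * h)) = X / (P * g * h)" using that by simp
    moreover have "L / (B * (P * g * h)) = inverse B * L / (P * g * h)" by (simp add: divide_inverse)
    ultimately show ?thesis by (simp only: add_divide_distrib)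
  qed
  have "(\<beta> * x) powr (\<mu> - \<nu> + 1) = \<beta> powr (\<mu> - \<nu> + 1) * x powr (\<mu> - \<nu> + 1)"
    using \<beta> assms by (simp add: powr_mult)
  thus ?thesis
    unfolding powr_minus using \<beta> by (simp only:) (rule alg, simp)
qed

text \<open>Multiply the unweighted inequality by E = exp(-\<beta> x). Since E < 1, subtracting the
  full power instead of E times it only lowers the bound.\<close>

lemma exp_lower_less_exp_lower_int:
  assumes "x > 0"
  shows "exp_lower x < exp_lower_int x"
proof -
  define E L p where "E = exp (- \<beta> * x)" and "L = lower_Gamma (\<mu> - \<nu> + 2) (\<beta> * x)"
    and "p = \<mu> - \<nu> + 1"
  have E: "0 < E" "E < 1"
    using \<beta> assms by (auto simp: E_def)
  have X: "x powr p / lead_denom > 0"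
    using assms param_ineqs' by (intro divide_pos_pos) auto
  have "E * lommel_quot x - E * (x powr p / lead_denom) < E * quot_int x"
    unfolding right_diff_distrib[symmetric] p_def using E integral_lommel_t_gt[OF \<nu> \<mu> assms]
    by (intro mult_strict_left_mono) auto
  moreover have "E * (x powr p / lead_denom) < 1 * (x powr p / lead_denom)"
    using E X by (intro mult_strict_right_mono) auto
  ultimately have *: "E * lommel_quot x - x powr p / lead_denom < E * quot_int x" by simp
  have "E * lommel_quot x - ((\<beta> * x) powr p + L) / (2 powr (\<mu> + 1) * \<beta> powr p
      * Gamma ((\<mu> - \<nu> + 3) / 2) * Gamma ((\<mu> + \<nu> + 3) / 2)) < E * quot_int x - \<beta> powr (- p) * L / lead_denom"
    using * exp_lower_fraction_eq[OF assms, of L] unfolding p_def by linarith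
  thus ?thesis
    using \<beta> unfolding E_def L_def p_def by (intro mult_strict_left_mono) simp_all
qed

text \<open>The factor exp(-\<beta> x) is pulled out of every term, in preparation for division by
  the integrand; the pure power thereby acquires \<open>exp (\<beta> * x)\<close>.\<close>

lemma exp_lower_has_derivative:
  assumes "x > 0"
  shows "(exp_lower has_real_derivative
    exp (- \<beta> * x) / (1 - \<beta>) * (lommel_t (\<mu> + 1) (\<nu> + 1) x / x powr \<nu>
      + (\<mu> - \<nu> + 1) * x powr (\<mu> - \<nu>) / lead_denom - \<beta> * lommel_quot x - \<beta> / lead_denom * x powr (\<mu> - \<nu> + 1)
      - exp (\<beta> * x) * ((\<mu> - \<nu> + 1) * x powr (\<mu> - \<nu>) / lead_denom))) (at x)"
proof -
  \<comment> \<open>The bound with its fraction split. Agreement is known for positive arguments, so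
    the derivative is transferred by equality near x.\<close>
  let ?S = "\<lambda>x. 1 / (1 - \<beta>) * (exp (- \<beta> * x) * lommel_quot x
       - (x powr (\<mu> - \<nu> + 1) / lead_denom + \<beta> powr (- (\<mu> - \<nu> + 1)) * lower_Gamma (\<mu> - \<nu> + 2) (\<beta> * x) / lead_denom))"
  have RS: "exp_lower y = ?S y" if "y > 0" for y
    by (simp only: exp_lower_fraction_eq[OF that])
  have alg: "1 / (1 - \<beta>) * (- \<beta> * E * F + F' * E - (P + E * X)) = E / (1 - \<beta>) * (F' - \<beta> * F - X - E' * P)"
    if "E * E' = 1" for E E' F F' X P :: real
  proof -
    have "P = E * (E' * P)" using that by (simp add: mult.assoc[symmetric])
    hence "- \<beta> * E * F + F' * E - (P + E * X) = E * (F' - \<beta> * F - X - E' * P)"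
      by (simp add: algebra_simps)
    thus ?thesis by simp
  qed
  have P: "((\<lambda>x. x powr (\<mu> - \<nu> + 1) / lead_denom) has_real_derivative (\<mu> - \<nu> + 1) * x powr (\<mu> - \<nu>) / lead_denom) (at x)"
    by (rule DERIV_cong[OF DERIV_cdivide[OF has_real_derivative_powr[OF assms]]]) simp
  have "(?S has_real_derivative
    exp (- \<beta> * x) / (1 - \<beta>) * (lommel_t (\<mu> + 1) (\<nu> + 1) x / x powr \<nu>
      + (\<mu> - \<nu> + 1) * x powr (\<mu> - \<nu>) / lead_denom - \<beta> * lommel_quot x - \<beta> / lead_denom * x powr (\<mu> - \<nu> + 1)
      - exp (\<beta> * x) * ((\<mu> - \<nu> + 1) * x powr (\<mu> - \<nu>) / lead_denom))) (at x)"
    by (rule DERIV_cong[OF DERIV_cmult[OF DERIV_diff[OF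
          DERIV_mult[OF exp_has_derivative lommel_t_over_powr_has_derivative'[OF \<nu>(2) param_ineqs'(1) assms]]
          DERIV_add[OF P lower_Gamma_has_derivative[OF assms]]]]])
       (rule alg, simp add: exp_add[symmetric])
  moreover have "\<forall>\<^sub>F y in nhds x. exp_lower y = ?S y"
    by (rule eventually_mono[OF eventually_nhds_in_open[of "{0<..}" x]]) (use assms RS in simp_all)
  ultimately show ?thesis
    by (subst DERIV_cong_ev[OF refl _ refl])
qed

section \<open>Tightness of the exponentially weighted bounds\<close>

lemma exp_int_integrand_at_top: "filterlim (\<lambda>x. exp (- \<beta> * x) * lommel_quot x) at_top at_top"
  using param_ineqs' \<beta> \<nu> by (intro exp_lommel_t_over_powr_at_top) auto

text \<open>The same logarithmic derivative in the normalisation of the bounds; both expressions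
  agree because they arise as derivatives of one function.\<close>

lemma lommel_quot_log_deriv:
  "((\<lambda>x. (lommel_t (\<mu> + 1) (\<nu> + 1) x / x powr \<nu> + (\<mu> - \<nu> + 1) * x powr (\<mu> - \<nu>) / lead_denom) / lommel_quot x) \<longlongrightarrow> 1) at_top"
proof (rule Lim_transform_eventually[OF lommel_t_over_powr_log_deriv[of \<nu> \<mu> \<nu>]])
  show "\<forall>\<^sub>F x in at_top. (\<nu> - \<nu>) / x + (lommel_t (\<mu> + 1) (\<nu> + 1) x
      + (x / 2) powr \<mu> * rGamma ((\<mu> - \<nu> + 1) / 2) * rGamma ((\<mu> + \<nu> + 3) / 2)) / lommel_t \<mu> \<nu> x
      = (lommel_t (\<mu> + 1) (\<nu> + 1) x / x powr \<nu> + (\<mu> - \<nu> + 1) * x powr (\<mu> - \<nu>) / lead_denom) / lommel_quot x"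
    using eventually_gt_at_top[of 0]
  proof eventually_elim
    case (elim x)
    have nz: "lommel_quot x \<noteq> 0" using elim by (rule lommel_quot_neq_0)
    have "lommel_quot x * ((\<nu> - \<nu>) / x + (lommel_t (\<mu> + 1) (\<nu> + 1) x
      + (x / 2) powr \<mu> * rGamma ((\<mu> - \<nu> + 1) / 2) * rGamma ((\<mu> + \<nu> + 3) / 2)) / lommel_t \<mu> \<nu> x)
      = lommel_t (\<mu> + 1) (\<nu> + 1) x / x powr \<nu> + (\<mu> - \<nu> + 1) * x powr (\<mu> - \<nu>) / lead_denom"
      by (rule DERIV_unique[OF lommel_t_over_powr_has_derivative lommel_t_over_powr_has_derivative'])
         (use \<nu> param_ineqs' elim in auto)
    thus ?case
      using nz by (metis nonzero_mult_div_cancel_left)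
  qed
qed (use \<nu> param_ineqs' in auto)

text \<open>l'Hopital's rule compares the integral with its own integrand: the quotient of
  derivatives is the logarithmic derivative of the latter, which tends to 1.\<close>

lemma quot_int_over_lommel_quot: "((\<lambda>x. quot_int x / lommel_quot x) \<longlongrightarrow> 1) at_top"
proof -
  have "filterlim lommel_quot at_top at_top"
    using \<nu> param_ineqs' by (intro lommel_t_over_powr_at_top) auto
  from tight_at_topI[OF quot_int_has_derivative lommel_t_over_powr_has_derivative' this lommel_quot_log_deriv]
  show ?thesis
    using \<nu> param_ineqs' by (simp add: tight_def)
qed

lemma powr_over_lommel_quot: "((\<lambda>x. x powr r / lommel_quot x) \<longlongrightarrow> 0) at_top"
proof (rule Lim_transform_eventually[OF powr_over_lommel_t_tendsto_0[of \<mu> \<nu> "r + \<nu>"]])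
  show "\<forall>\<^sub>F x in at_top. x powr (r + \<nu>) / lommel_t \<mu> \<nu> x = x powr r / lommel_quot x"
    using eventually_gt_at_top[of 0] by eventually_elim (simp add: powr_add)
qed (use \<nu> param_ineqs' in auto)

text \<open>After division by the integrand the limit is (1 - \<beta>)/(1 - \<beta>): the integral
  contributes -\<beta> by \<open>quot_int_over_lommel_quot\<close>, and the power vanishes.\<close>

lemma exp_lower_int_tight: "tight exp_int exp_lower_int at_top"
proof (rule tight_at_topI[OF exp_int_has_derivative exp_lower_int_has_derivative exp_int_integrand_at_top])
  let ?g = "\<lambda>x. 1 / (1 - \<beta>) * (1 - \<beta> * (quot_int x / lommel_quot x) - \<beta> / lead_denom * (x powr (\<mu> - \<nu> + 1) / lommel_quot x))"
  have "(?g \<longlongrightarrow> 1 / (1 - \<beta>) * (1 - \<beta> * 1 - \<beta> / lead_denom * 0)) at_top"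
    by (intro tendsto_intros quot_int_over_lommel_quot powr_over_lommel_quot)
  hence g: "(?g \<longlongrightarrow> 1) at_top" using \<beta> by simp
  have alg: "1 / (1 - \<beta>) * (1 - \<beta> * (J / F) - k * (X / F))
      = E / (1 - \<beta>) * (F - \<beta> * J - k * X) / (E * F)" if "E \<noteq> 0" "F \<noteq> 0" for E F J X k :: real
  proof -
    have "F - \<beta> * J - k * X = F * (1 - \<beta> * (J / F) - k * (X / F))"
      using that by (simp add: right_diff_distrib)
    thus ?thesis using that by simp
  qed
  have "\<forall>\<^sub>F x in at_top. ?g x = exp (- \<beta> * x) / (1 - \<beta>) *
      (lommel_quot x - \<beta> * quot_int x - \<beta> / lead_denom * x powr (\<mu> - \<nu> + 1)) / (exp (- \<beta> * x) * lommel_quot x)"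
    using eventually_gt_at_top[of 0]
  proof eventually_elim
    case (elim x)
    show ?case by (rule alg[OF exp_not_eq_zero lommel_quot_neq_0[OF elim]])
  qed
  from Lim_transform_eventually[OF g this]
  show "((\<lambda>x. exp (- \<beta> * x) / (1 - \<beta>) *
      (lommel_quot x - \<beta> * quot_int x - \<beta> / lead_denom * x powr (\<mu> - \<nu> + 1)) / (exp (- \<beta> * x) * lommel_quot x)) \<longlongrightarrow> 1) at_top" .
qed

text \<open>The limit is again (1 - \<beta>)/(1 - \<beta>), now with 1 from the logarithmic
  derivative and -\<beta> from differentiating the exponential. The term with
  \<open>exp (\<beta> * x)\<close> vanishes because, as \<beta> < 1, \<open>lommel_quot\<close>
  outgrows this exponential times any power.\<close>

lemma exp_lower_tight: "tight exp_int exp_lower at_top"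
proof (rule tight_at_topI[OF exp_int_has_derivative exp_lower_has_derivative exp_int_integrand_at_top])
  let ?h = "\<lambda>x. (\<mu> - \<nu> + 1) * x powr (\<mu> - \<nu>) / lead_denom"
  let ?f' = "\<lambda>x. lommel_t (\<mu> + 1) (\<nu> + 1) x / x powr \<nu> + ?h x"
  let ?g = "\<lambda>x. 1 / (1 - \<beta>) * (?f' x / lommel_quot x - \<beta> - \<beta> / lead_denom * (x powr (\<mu> - \<nu> + 1) / lommel_quot x)
      - (\<mu> - \<nu> + 1) / lead_denom * inverse (exp (- \<beta> * x) * (lommel_t \<mu> \<nu> x / x powr \<mu>)))"
  \<comment> \<open>Dividing by \<open>x powr \<mu>\<close> instead of \<open>x powr \<nu>\<close>
    takes care of the factor x^(\<mu> - \<nu>) next to the exponential.\<close>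
  have "filterlim (\<lambda>x. exp (- \<beta> * x) * (lommel_t \<mu> \<nu> x / x powr \<mu>)) at_top at_top"
    using param_ineqs' \<beta> \<nu> by (intro exp_lommel_t_over_powr_at_top) auto
  note inv = tendsto_inverse_0_at_top[OF this]
  have "(?g \<longlongrightarrow> 1 / (1 - \<beta>) * (1 - \<beta> - \<beta> / lead_denom * 0 - (\<mu> - \<nu> + 1) / lead_denom * 0)) at_top"
    by (intro tendsto_mult tendsto_diff tendsto_const lommel_quot_log_deriv powr_over_lommel_quot inv)
  hence g: "(?g \<longlongrightarrow> 1) at_top" using \<beta> by simp
  have alg: "1 / (1 - \<beta>) * (F' / F - \<beta> - k * (X / F) - Z)
      = E / (1 - \<beta>) * (F' - \<beta> * F - k * X - Y) / (E * F)"
    if "E \<noteq> 0" "F \<noteq> 0" "Y = F * Z" for E F F' X Y Z k :: real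
  proof -
    have "F' - \<beta> * F - k * X - Y = F * (F' / F - \<beta> - k * (X / F) - Z)"
      using that by (simp add: right_diff_distrib)
    thus ?thesis using that by simp
  qed
  have "\<forall>\<^sub>F x in at_top. ?g x = exp (- \<beta> * x) / (1 - \<beta>) *
      (?f' x - \<beta> * lommel_quot x - \<beta> / lead_denom * x powr (\<mu> - \<nu> + 1) - exp (\<beta> * x) * ?h x) / (exp (- \<beta> * x) * lommel_quot x)"
    using eventually_gt_at_top[of 0]
  proof eventually_elim
    case (elim x)
    have t: "lommel_t \<mu> \<nu> x \<noteq> 0"
      using lommel_quot_pos[OF elim] by auto
    have "inverse (exp (- \<beta> * x) * (T / x powr \<mu>)) = exp (\<beta> * x) * x powr (\<mu> - \<nu>) / (T / x powr \<nu>)" for T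
      using elim by (simp add: powr_diff exp_minus field_simps)
    hence "exp (\<beta> * x) * ?h x =
        lommel_quot x * ((\<mu> - \<nu> + 1) / lead_denom * inverse (exp (- \<beta> * x) * (lommel_t \<mu> \<nu> x / x powr \<mu>)))"
      using t elim by simp
    thus ?case by (rule alg[OF exp_not_eq_zero lommel_quot_neq_0[OF elim]])
  qed
  from Lim_transform_eventually[OF g this]
  show "((\<lambda>x. exp (- \<beta> * x) / (1 - \<beta>) *
      (?f' x - \<beta> * lommel_quot x - \<beta> / lead_denom * x powr (\<mu> - \<nu> + 1) - exp (\<beta> * x) * ?h x) / (exp (- \<beta> * x) * lommel_quot x)) \<longlongrightarrow> 1) at_top" .
qed

end

theorem theorem2p2:
  fixes \<beta> n \<mu> \<nu> :: real
  assumes "0 < \<beta>" and "\<beta> < 1" and "n > -1"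
  shows
    "let I = (\<lambda>x. integral {0..x} (\<lambda>u. lommel_t \<mu> \<nu> u / u powr \<nu>));
         I\<^sub>n = (\<lambda>x. integral {0..x} (\<lambda>u. lommel_t (\<mu> + n) (\<nu> + n) u / u powr \<nu>));
         I\<^sub>\<beta> = (\<lambda>x. integral {0..x} (\<lambda>u. exp (- \<beta> * u) * (lommel_t \<mu> \<nu> u / u powr \<nu>)));
         R\<^sub>1 = (\<lambda>x. lommel_t \<mu> \<nu> x / x powr \<nu>
                - x powr (\<mu> - \<nu> + 1)
                  / (2 powr (\<mu> + 1) * Gamma ((\<mu> - \<nu> + 3) / 2) * Gamma ((\<mu> + \<nu> + 3) / 2)));
         R\<^sub>2 = (\<lambda>x. lommel_t (\<mu> + n + 1) (\<nu> + n + 1) x / x powr \<nu>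
                - b_const \<mu> \<nu> n * x powr (\<mu> - \<nu> + n + 2));
         R\<^sub>3 = (\<lambda>x. 2 * (\<nu> + n + 1) / (n + 1)
                  * (lommel_t (\<mu> + n + 1) (\<nu> + n + 1) x / x powr \<nu>)
                - (2 * \<nu> + n + 1) / (n + 1)
                  * (lommel_t (\<mu> + n + 3) (\<nu> + n + 3) x / x powr \<nu>)
                + c_const \<mu> \<nu> n * x powr (\<mu> - \<nu> + n + 4)
                - d_const \<mu> \<nu> n * x powr (\<mu> - \<nu> + n + 2));
         R\<^sub>4 = (\<lambda>x. 1 / (1 - \<beta>) *
                (exp (- \<beta> * x) * integral {0..x} (\<lambda>u. lommel_t \<mu> \<nu> u / u powr \<nu>)
                 - \<beta> powr (- (\<mu> - \<nu> + 1)) * lower_Gamma (\<mu> - \<nu> + 2) (\<beta> * x)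
                   / (2 powr (\<mu> + 1) * Gamma ((\<mu> - \<nu> + 3) / 2) * Gamma ((\<mu> + \<nu> + 3) / 2))));
         R\<^sub>5 = (\<lambda>x. 1 / (1 - \<beta>) *
                (exp (- \<beta> * x) * (lommel_t \<mu> \<nu> x / x powr \<nu>)
                 - ((\<beta> * x) powr (\<mu> - \<nu> + 1) + lower_Gamma (\<mu> - \<nu> + 2) (\<beta> * x))
                   / (2 powr (\<mu> + 1) * \<beta> powr (\<mu> - \<nu> + 1)
                      * Gamma ((\<mu> - \<nu> + 3) / 2) * Gamma ((\<mu> + \<nu> + 3) / 2))))
     in
       (\<mu> > - 3 / 2 \<and> - 1 / 2 \<le> \<nu> \<and> \<nu> < \<mu> + 1 \<longrightarrow>
          (\<forall>x>0. I x > R\<^sub>1 x) \<and> tight I R\<^sub>1 at_top) \<and>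
       (\<mu> > - (n + 3) / 2 \<and> - (n + 1) / 2 < \<nu> \<and> \<nu> < \<mu> + 1 \<longrightarrow>
          (\<forall>x>0. I\<^sub>n x > R\<^sub>2 x) \<and> tight I\<^sub>n R\<^sub>2 at_top \<and>
          (\<forall>x>0. I\<^sub>n x < R\<^sub>3 x) \<and> tight I\<^sub>n R\<^sub>3 at_top \<and> tight I\<^sub>n R\<^sub>3 (at_right 0)) \<and>
       (\<mu> > - 3 / 2 \<and> - 1 / 2 \<le> \<nu> \<and> \<nu> < \<mu> + 1 \<longrightarrow>
          (\<forall>x>0. I\<^sub>\<beta> x > R\<^sub>4 x) \<and> tight I\<^sub>\<beta> R\<^sub>4 at_top \<and>
          (\<forall>x>0. I\<^sub>\<beta> x > R\<^sub>5 x) \<and> tight I\<^sub>\<beta> R\<^sub>5 at_top) \<and>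
       (2 * \<nu> + n = -1 \<and> \<mu> > - (n + 3) / 2 \<and> \<nu> < \<mu> + 1 \<longrightarrow>
          (\<forall>x>0. I\<^sub>n x = R\<^sub>2 x \<and> I\<^sub>n x = R\<^sub>3 x))"
proof -
  \<comment> \<open>The context for shifted parameters asks for the weak bound on \<nu>, which
    follows from the strict one and, for equality, from 2\<nu> + n = -1.\<close>
  have \<nu>: "- (n + 1) / 2 < \<nu> \<Longrightarrow> - (n + 1) / 2 \<le> \<nu>"
    "- (n + 1) / 2 < \<nu> \<Longrightarrow> 2 * \<nu> + n + 1 > 0"
    "2 * \<nu> + n = - 1 \<Longrightarrow> - (n + 1) / 2 \<le> \<nu>"
    by (simp_all add: field_simps)
  show ?thesis
    unfolding Let_def
  proof (intro conjI impI allI, goal_cases)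
    case (1 x) thus ?case by (intro integral_lommel_t_gt) auto
  next
    case 2 thus ?case by (intro integral_lommel_t_tight) auto
  next
    case (3 x) thus ?case using assms \<nu> by (intro shift_lower_less_shift_int) auto
  next
    case 4 thus ?case using assms \<nu> by (intro shift_lower_tight) auto
  next
    case (5 x) thus ?case using assms \<nu> by (intro shift_int_less_shift_upper) auto
  next
    case 6 thus ?case using assms \<nu> by (intro shift_upper_tight) auto
  next
    case 7 thus ?case using assms \<nu> by (intro shift_upper_tight_at_right_0) auto
  next
    case (8 x) thus ?case using assms by (intro exp_lower_int_less_exp_int) auto
  next
    case 9 thus ?case using assms by (intro exp_lower_int_tight) auto
  next
    case (10 x) thus ?case using assms by (intro less_trans[OF exp_lower_less_exp_lower_int exp_lower_int_less_exp_int]) auto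
  next
    case 11 thus ?case using assms by (intro exp_lower_tight) auto
  next
    case (12 x) thus ?case using assms \<nu> by (intro shift_int_eq[THEN conjunct1]) auto
  next
    case (13 x) thus ?case using assms \<nu> by (intro shift_int_eq[THEN conjunct2]) auto
  qed
qed

end
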